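(* Let $S$ be a simple object in a finitary abelian category $\mathscr A$ with the finite length property. Let $\mathscr A'=\mathrm{Add}_{\mathscr A}S$ and let $\mathscr A''$ be the maximal full subcategory of $\mathscr A$ whose objects $M$ satisfy $[M:S]=0$. (a) If $S$ is injective, then $(\mathscr A',\mathscr A'')$ is a factorizing pair for $\mathscr A$. (b) If $S$ is projective, then $(\mathscr A'',\mathscr A')$ is a factorizing pair for $\mathscr A$.
   Context: An (essentially small) abelian category is finitary if all $\mathrm{Hom}$ and $\mathrm{Ext}^1$ sets are finite; it has the finite length property if every object has a finite composition series. $[M:S]$ is the Jordan--Hölder multiplicity of $S$ in $M$. $\mathrm{Add}_{\mathscr A}S$ is the minimal additive full subcategory of $\mathscr A$ containing all direct summands of $S$ (i.e. objects isomorphic to $S^{\oplus a}$, $a\ge0$). An ordered pair $(\mathscr B,\mathscr C)$ of full subcategories of $\mathscr A$ is a factorizing pair for $\mathscr A$ if $\mathscr B,\mathscr C$ are closed under extensions and every object $M$ of $\mathscr A$ has a unique subobject $M''$ that is an object of $\mathscr C$ and such that $M/M''$ is an object of $\mathscr B$. *)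

theory Defs
  imports "HOL-Algebra.Group"
begin

section \<open>Abelian categories\<close>

text \<open>
  Objects form a set inside the type \<^typ>\<open>'o\<close>, and each arrow has a definite domain and codomain.
  A category represented in this way is small, so essential smallness needs no separate hypothesis.
  Values of the operations outside their natural domain (non-composable arrows, and so on) are
  unspecified and never used.
\<close>

record ('o, 'm) cat =
  Ob :: "'o set"
  Arr :: "'m set"
  Dom :: "'m \<Rightarrow> 'o"
  Cod :: "'m \<Rightarrow> 'o"
  Id :: "'o \<Rightarrow> 'm"
  Comp :: "'m \<Rightarrow> 'm \<Rightarrow> 'm"  (infixr \<open>\<cdot>\<index>\<close> 70)
  Plus :: "'m \<Rightarrow> 'm \<Rightarrow> 'm"
  Zero :: "'o \<Rightarrow> 'o \<Rightarrow> 'm"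

definition Hom :: "('o, 'm) cat \<Rightarrow> 'o \<Rightarrow> 'o \<Rightarrow> 'm set" where
  "Hom C X Y = {f \<in> Arr C. Dom C f = X \<and> Cod C f = Y}"

definition Hom_group :: "('o, 'm) cat \<Rightarrow> 'o \<Rightarrow> 'o \<Rightarrow> 'm monoid" where
  "Hom_group C X Y = \<lparr>carrier = Hom C X Y, monoid.mult = Plus C, one = Zero C X Y\<rparr>"

locale category =
  fixes C :: "('o, 'm) cat" (structure)
  assumes Dom_in_Ob: "f \<in> Arr C \<Longrightarrow> Dom C f \<in> Ob C"
    and Cod_in_Ob: "f \<in> Arr C \<Longrightarrow> Cod C f \<in> Ob C"
    and Id_in_Hom: "X \<in> Ob C \<Longrightarrow> Id C X \<in> Hom C X X"
    and Comp_in_Hom: "\<lbrakk>g \<in> Hom C Y Z; f \<in> Hom C X Y\<rbrakk> \<Longrightarrow> g \<cdot> f \<in> Hom C X Z"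
    and Comp_Id: "f \<in> Hom C X Y \<Longrightarrow> f \<cdot> Id C X = f"
    and Id_Comp: "f \<in> Hom C X Y \<Longrightarrow> Id C Y \<cdot> f = f"
    and Comp_assoc: "\<lbrakk>h \<in> Hom C Y Z; g \<in> Hom C X Y; f \<in> Hom C W X\<rbrakk>
      \<Longrightarrow> (h \<cdot> g) \<cdot> f = h \<cdot> (g \<cdot> f)"

locale preadditive_category = category +
  assumes Hom_comm_group: "\<lbrakk>X \<in> Ob C; Y \<in> Ob C\<rbrakk> \<Longrightarrow> comm_group (Hom_group C X Y)"
    and Comp_Plus: "\<lbrakk>h \<in> Hom C Y Z; f \<in> Hom C X Y; g \<in> Hom C X Y\<rbrakk>
      \<Longrightarrow> h \<cdot> Plus C f g = Plus C (h \<cdot> f) (h \<cdot> g)"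
    and Plus_Comp: "\<lbrakk>f \<in> Hom C Y Z; g \<in> Hom C Y Z; h \<in> Hom C X Y\<rbrakk>
      \<Longrightarrow> Plus C f g \<cdot> h = Plus C (f \<cdot> h) (g \<cdot> h)"

definition zero_object :: "('o, 'm) cat \<Rightarrow> 'o \<Rightarrow> bool" where
  "zero_object C Z \<longleftrightarrow> Z \<in> Ob C \<and>
     (\<forall>X\<in>Ob C. (\<exists>!f. f \<in> Hom C X Z) \<and> (\<exists>!f. f \<in> Hom C Z X))"

definition monic :: "('o, 'm) cat \<Rightarrow> 'm \<Rightarrow> bool" where
  "monic C m \<longleftrightarrow> m \<in> Arr C \<and>
     (\<forall>X. \<forall>f\<in>Hom C X (Dom C m). \<forall>g\<in>Hom C X (Dom C m).
        m \<cdot>\<^bsub>C\<^esub> f = m \<cdot>\<^bsub>C\<^esub> g \<longrightarrow> f = g)"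

definition epic :: "('o, 'm) cat \<Rightarrow> 'm \<Rightarrow> bool" where
  "epic C e \<longleftrightarrow> e \<in> Arr C \<and>
     (\<forall>X. \<forall>f\<in>Hom C (Cod C e) X. \<forall>g\<in>Hom C (Cod C e) X.
        f \<cdot>\<^bsub>C\<^esub> e = g \<cdot>\<^bsub>C\<^esub> e \<longrightarrow> f = g)"

definition iso_arrow :: "('o, 'm) cat \<Rightarrow> 'm \<Rightarrow> bool" where
  "iso_arrow C f \<longleftrightarrow> f \<in> Arr C \<and>
     (\<exists>g\<in>Hom C (Cod C f) (Dom C f).
        g \<cdot>\<^bsub>C\<^esub> f = Id C (Dom C f) \<and> f \<cdot>\<^bsub>C\<^esub> g = Id C (Cod C f))"

definition isomorphic :: "('o, 'm) cat \<Rightarrow> 'o \<Rightarrow> 'o \<Rightarrow> bool" where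
  "isomorphic C X Y \<longleftrightarrow> (\<exists>f\<in>Hom C X Y. iso_arrow C f)"

definition is_kernel :: "('o, 'm) cat \<Rightarrow> 'm \<Rightarrow> 'm \<Rightarrow> bool" where
  "is_kernel C k f \<longleftrightarrow> f \<in> Arr C \<and> k \<in> Arr C \<and> Cod C k = Dom C f \<and>
     f \<cdot>\<^bsub>C\<^esub> k = Zero C (Dom C k) (Cod C f) \<and>
     (\<forall>X. \<forall>h\<in>Hom C X (Dom C f). f \<cdot>\<^bsub>C\<^esub> h = Zero C X (Cod C f) \<longrightarrow>
        (\<exists>!u. u \<in> Hom C X (Dom C k) \<and> k \<cdot>\<^bsub>C\<^esub> u = h))"

definition is_cokernel :: "('o, 'm) cat \<Rightarrow> 'm \<Rightarrow> 'm \<Rightarrow> bool" where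
  "is_cokernel C q f \<longleftrightarrow> f \<in> Arr C \<and> q \<in> Arr C \<and> Dom C q = Cod C f \<and>
     q \<cdot>\<^bsub>C\<^esub> f = Zero C (Dom C f) (Cod C q) \<and>
     (\<forall>X. \<forall>h\<in>Hom C (Cod C f) X. h \<cdot>\<^bsub>C\<^esub> f = Zero C (Dom C f) X \<longrightarrow>
        (\<exists>!u. u \<in> Hom C (Cod C q) X \<and> u \<cdot>\<^bsub>C\<^esub> q = h))"

definition biproduct :: "('o, 'm) cat \<Rightarrow> 'o \<Rightarrow> 'o \<Rightarrow> 'o \<Rightarrow> bool" where
  "biproduct C X Y Z \<longleftrightarrow> X \<in> Ob C \<and> Y \<in> Ob C \<and> Z \<in> Ob C \<and>
     (\<exists>i\<in>Hom C X Z. \<exists>j\<in>Hom C Y Z. \<exists>p\<in>Hom C Z X. \<exists>q\<in>Hom C Z Y.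
        p \<cdot>\<^bsub>C\<^esub> i = Id C X \<and> q \<cdot>\<^bsub>C\<^esub> j = Id C Y \<and>
        q \<cdot>\<^bsub>C\<^esub> i = Zero C X Y \<and> p \<cdot>\<^bsub>C\<^esub> j = Zero C Y X \<and>
        Plus C (i \<cdot>\<^bsub>C\<^esub> p) (j \<cdot>\<^bsub>C\<^esub> q) = Id C Z)"

locale abelian_category = preadditive_category +
  assumes zero_object_exists: "\<exists>Z. zero_object C Z"
    and biproduct_exists: "\<lbrakk>X \<in> Ob C; Y \<in> Ob C\<rbrakk> \<Longrightarrow> \<exists>Z. biproduct C X Y Z"
    and kernel_exists: "f \<in> Arr C \<Longrightarrow> \<exists>k. is_kernel C k f"
    and cokernel_exists: "f \<in> Arr C \<Longrightarrow> \<exists>q. is_cokernel C q f"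
    and monic_normal: "monic C m \<Longrightarrow> \<exists>f. is_kernel C m f"
    and epic_normal: "epic C e \<Longrightarrow> \<exists>f. is_cokernel C e f"

section \<open>Finitary and finite length categories\<close>

definition short_exact :: "('o, 'm) cat \<Rightarrow> 'm \<Rightarrow> 'm \<Rightarrow> bool" where
  "short_exact C i p \<longleftrightarrow> is_kernel C i p \<and> is_cokernel C p i"

text \<open>
  \<open>Ext1 C X Y\<close> is the set of Yoneda equivalence classes of extensions \<open>0 \<rightarrow> Y \<rightarrow> E \<rightarrow> X \<rightarrow> 0\<close>.
\<close>

definition extensions :: "('o, 'm) cat \<Rightarrow> 'o \<Rightarrow> 'o \<Rightarrow> ('m \<times> 'm) set" where
  "extensions C X Y = {(i, p). short_exact C i p \<and> Dom C i = Y \<and> Cod C p = X}"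

definition extension_equiv :: "('o, 'm) cat \<Rightarrow> 'o \<Rightarrow> 'o \<Rightarrow> (('m \<times> 'm) \<times> ('m \<times> 'm)) set" where
  "extension_equiv C X Y = {((i, p), (i', p')).
     (i, p) \<in> extensions C X Y \<and> (i', p') \<in> extensions C X Y \<and>
     (\<exists>f\<in>Hom C (Cod C i) (Cod C i').
        iso_arrow C f \<and> f \<cdot>\<^bsub>C\<^esub> i = i' \<and> p' \<cdot>\<^bsub>C\<^esub> f = p)}"

definition Ext1 :: "('o, 'm) cat \<Rightarrow> 'o \<Rightarrow> 'o \<Rightarrow> ('m \<times> 'm) set set" where
  "Ext1 C X Y = extensions C X Y // extension_equiv C X Y"

locale finitary_abelian_category = abelian_category +
  assumes finite_Hom: "\<lbrakk>X \<in> Ob C; Y \<in> Ob C\<rbrakk> \<Longrightarrow> finite (Hom C X Y)"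
    and finite_Ext1: "\<lbrakk>X \<in> Ob C; Y \<in> Ob C\<rbrakk> \<Longrightarrow> finite (Ext1 C X Y)"

definition simple_object :: "('o, 'm) cat \<Rightarrow> 'o \<Rightarrow> bool" where
  "simple_object C S \<longleftrightarrow> S \<in> Ob C \<and> \<not> zero_object C S \<and>
     (\<forall>m. monic C m \<and> Cod C m = S \<longrightarrow> zero_object C (Dom C m) \<or> iso_arrow C m)"

text \<open>
  A composition series \<open>0 = X 0 \<subset> X 1 \<subset> \<dots> \<subset> X n = M\<close>, with inclusions
  \<open>j k : X k \<rightarrow> X (k + 1)\<close> and quotient maps \<open>p k\<close> from \<open>X (k + 1)\<close> onto the composition
  factor \<open>Cod C (p k)\<close>.
\<close>

definition composition_series ::
  "('o, 'm) cat \<Rightarrow> 'o \<Rightarrow> nat \<Rightarrow> (nat \<Rightarrow> 'o) \<Rightarrow> (nat \<Rightarrow> 'm) \<Rightarrow> (nat \<Rightarrow> 'm) \<Rightarrow> bool" where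
  "composition_series C M n X j p \<longleftrightarrow> zero_object C (X 0) \<and> X n = M \<and>
     (\<forall>k<n. j k \<in> Hom C (X k) (X (Suc k)) \<and> short_exact C (j k) (p k) \<and>
            simple_object C (Cod C (p k)))"

definition finite_length_category :: "('o, 'm) cat \<Rightarrow> bool" where
  "finite_length_category C \<longleftrightarrow> (\<forall>M\<in>Ob C. \<exists>n X j p. composition_series C M n X j p)"

text \<open>
  The number of composition factors of \<open>M\<close> isomorphic to \<open>S\<close>; by the Jordan--Hoelder theorem
  it does not depend on the composition series chosen.
\<close>

definition JH_multiplicity :: "('o, 'm) cat \<Rightarrow> 'o \<Rightarrow> 'o \<Rightarrow> nat" where
  "JH_multiplicity C M S = (SOME a. \<exists>n X j p. composition_series C M n X j p \<and>
     a = card {k. k < n \<and> isomorphic C (Cod C (p k)) S})"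

definition injective_object :: "('o, 'm) cat \<Rightarrow> 'o \<Rightarrow> bool" where
  "injective_object C I \<longleftrightarrow> I \<in> Ob C \<and>
     (\<forall>m. monic C m \<longrightarrow> (\<forall>f\<in>Hom C (Dom C m) I. \<exists>g\<in>Hom C (Cod C m) I. g \<cdot>\<^bsub>C\<^esub> m = f))"

definition projective_object :: "('o, 'm) cat \<Rightarrow> 'o \<Rightarrow> bool" where
  "projective_object C P \<longleftrightarrow> P \<in> Ob C \<and>
     (\<forall>e. epic C e \<longrightarrow> (\<forall>f\<in>Hom C P (Cod C e). \<exists>g\<in>Hom C P (Dom C e). e \<cdot>\<^bsub>C\<^esub> g = f))"

section \<open>Full subcategories and factorizing pairs\<close>

text \<open>
  A full subcategory is given by its set of objects. Since a biproduct is only determined up to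
  isomorphism and all biproducts of members are required to be members, additive full subcategories
  are closed under isomorphism. They form a family closed under intersection, so the minimal one
  containing the direct summands of \<open>S\<close> is the intersection \<open>Add C S\<close>.
\<close>

definition additive_full_subcategory :: "('o, 'm) cat \<Rightarrow> 'o set \<Rightarrow> bool" where
  "additive_full_subcategory C B \<longleftrightarrow> B \<subseteq> Ob C \<and> (\<forall>Z. zero_object C Z \<longrightarrow> Z \<in> B) \<and>
     (\<forall>X\<in>B. \<forall>Y\<in>B. \<forall>Z. biproduct C X Y Z \<longrightarrow> Z \<in> B)"

definition direct_summand :: "('o, 'm) cat \<Rightarrow> 'o \<Rightarrow> 'o \<Rightarrow> bool" where
  "direct_summand C X S \<longleftrightarrow> (\<exists>Y. biproduct C X Y S)"

definition Add :: "('o, 'm) cat \<Rightarrow> 'o \<Rightarrow> 'o set" where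
  "Add C S = \<Inter>{B. additive_full_subcategory C B \<and> (\<forall>X. direct_summand C X S \<longrightarrow> X \<in> B)}"

definition objects_without_factor :: "('o, 'm) cat \<Rightarrow> 'o \<Rightarrow> 'o set" where
  "objects_without_factor C S = {M \<in> Ob C. JH_multiplicity C M S = 0}"

definition extension_closed :: "('o, 'm) cat \<Rightarrow> 'o set \<Rightarrow> bool" where
  "extension_closed C B \<longleftrightarrow>
     (\<forall>i p. short_exact C i p \<and> Dom C i \<in> B \<and> Cod C p \<in> B \<longrightarrow> Cod C i \<in> B)"

text \<open>
  A subobject of \<open>M\<close> is a class of monomorphisms into \<open>M\<close> modulo isomorphism over \<open>M\<close>.
\<close>

definition monics_into :: "('o, 'm) cat \<Rightarrow> 'o \<Rightarrow> 'm set" where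
  "monics_into C M = {m. monic C m \<and> Cod C m = M}"

definition subobject_equiv :: "('o, 'm) cat \<Rightarrow> 'o \<Rightarrow> ('m \<times> 'm) set" where
  "subobject_equiv C M = {(m, m'). m \<in> monics_into C M \<and> m' \<in> monics_into C M \<and>
     (\<exists>u\<in>Hom C (Dom C m) (Dom C m'). iso_arrow C u \<and> m' \<cdot>\<^bsub>C\<^esub> u = m)}"

definition subobjects :: "('o, 'm) cat \<Rightarrow> 'o \<Rightarrow> 'm set set" where
  "subobjects C M = monics_into C M // subobject_equiv C M"

text \<open>
  A subobject \<open>U\<close> and its quotient are only determined up to isomorphism; they are said to belong
  to a full subcategory if some representative does.
\<close>

definition factorizing_pair :: "('o, 'm) cat \<Rightarrow> 'o set \<Rightarrow> 'o set \<Rightarrow> bool" where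
  "factorizing_pair C B D \<longleftrightarrow> B \<subseteq> Ob C \<and> D \<subseteq> Ob C \<and>
     extension_closed C B \<and> extension_closed C D \<and>
     (\<forall>M\<in>Ob C. \<exists>!U. U \<in> subobjects C M \<and>
        (\<exists>m\<in>U. Dom C m \<in> D \<and> (\<exists>q. is_cokernel C q m \<and> Cod C q \<in> B)))"

end

theory Submission imports Defs
begin

text \<open>
  If \<open>S\<close> is injective, \<open>Hom(-, S)\<close> is exact, so by Schur's lemma \<open>[M : S] = 0\<close> holds iff
  \<open>Hom(M, S) = 0\<close>, whichever composition series is used; Jordan--Hoelder is not needed.
  Objects of \<open>Add S\<close> are injective, hence extensions between them split, and they receive no
  nonzero arrow from an object \<open>M\<close> with \<open>Hom(M, S) = 0\<close>, which gives uniqueness of the subobject.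
  For existence one passes from \<open>M\<close> to the kernel \<open>K\<close> of a nonzero arrow \<open>M \<rightarrow> S\<close>: restriction
  \<open>Hom(M, S) \<rightarrow> Hom(K, S)\<close> is surjective but not injective, so these finite sets shrink and the
  process stops. The projective case is the injective case in the opposite category.
\<close>

section \<open>Opposite categories\<close>

text \<open>Objects and arrows stay the same sets, so classes of objects can be compared literally
  in both categories. \<open>Zero\<close> swaps its arguments because the Hom set from
  \<open>X\<close> to \<open>Y\<close> is now the old one from \<open>Y\<close> to
  \<open>X\<close>.\<close>

definition opposite :: "('o, 'm) cat \<Rightarrow> ('o, 'm) cat" where
  "opposite C = \<lparr>Ob = Ob C, Arr = Arr C, Dom = Cod C, Cod = Dom C, Id = Id C,
     Comp = (\<lambda>f g. g \<cdot>\<^bsub>C\<^esub> f), Plus = Plus C, Zero = (\<lambda>X Y. Zero C Y X)\<rparr>"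

lemma opposite_simps [simp]:
  "Ob (opposite C) = Ob C" "Arr (opposite C) = Arr C"
  "Dom (opposite C) = Cod C" "Cod (opposite C) = Dom C"
  "Id (opposite C) = Id C" "f \<cdot>\<^bsub>opposite C\<^esub> g = g \<cdot>\<^bsub>C\<^esub> f"
  "Plus (opposite C) = Plus C" "Zero (opposite C) X Y = Zero C Y X"
  by (simp_all add: opposite_def)

lemma Hom_opposite [simp]: "Hom (opposite C) X Y = Hom C Y X"
  by (auto simp: Hom_def)

lemma Hom_group_opposite [simp]: "Hom_group (opposite C) X Y = Hom_group C Y X"
  by (simp add: Hom_group_def)

lemma zero_object_opposite [simp]: "zero_object (opposite C) Z \<longleftrightarrow> zero_object C Z"
  by (auto simp: zero_object_def)

lemma monic_opposite [simp]: "monic (opposite C) f \<longleftrightarrow> epic C f"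
  by (simp add: monic_def epic_def)

lemma epic_opposite [simp]: "epic (opposite C) f \<longleftrightarrow> monic C f"
  by (simp add: monic_def epic_def)

lemma iso_arrow_opposite [simp]: "iso_arrow (opposite C) f \<longleftrightarrow> iso_arrow C f"
  by (auto simp: iso_arrow_def)

lemma is_kernel_opposite [simp]: "is_kernel (opposite C) k f \<longleftrightarrow> is_cokernel C k f"
  by (simp add: is_kernel_def is_cokernel_def)

lemma is_cokernel_opposite [simp]: "is_cokernel (opposite C) k f \<longleftrightarrow> is_kernel C k f"
  by (simp add: is_kernel_def is_cokernel_def)

lemma short_exact_opposite [simp]: "short_exact (opposite C) p i \<longleftrightarrow> short_exact C i p"
  by (auto simp: short_exact_def)

lemma biproduct_opposite [simp]: "biproduct (opposite C) X Y Z \<longleftrightarrow> biproduct C X Y Z"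
  unfolding biproduct_def by (simp, blast)

lemma injective_object_opposite [simp]:
  "injective_object (opposite C) S \<longleftrightarrow> projective_object C S"
  by (simp add: injective_object_def projective_object_def)

text \<open>Zero objects and biproducts are self-dual, and nothing else enters the
  construction.\<close>

lemma Add_opposite [simp]: "Add (opposite C) S = Add C S"
  by (simp add: Add_def additive_full_subcategory_def direct_summand_def)

text \<open>The middle object is read off as \<open>Cod C i\<close> on one side and as
  \<open>Dom C p\<close> on the other; exactness identifies the two.\<close>

lemma extension_closed_opposite [simp]:
  "extension_closed (opposite C) B \<longleftrightarrow> extension_closed C B"
proof -
  have "Cod C i = Dom C p" if "short_exact C i p" for i p
    using that by (simp add: short_exact_def is_kernel_def)
  then show ?thesis
    unfolding extension_closed_def opposite_simps short_exact_opposite by metis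
qed

lemma category_opposite:
  assumes "category C"
  shows "category (opposite C)"
proof -
  interpret category C by fact
  show ?thesis
    by (rule category.intro; unfold opposite_simps Hom_opposite;
        rule Dom_in_Ob Cod_in_Ob Id_in_Hom Comp_in_Hom Comp_Id Id_Comp Comp_assoc[symmetric];
        assumption)
qed

lemma preadditive_category_opposite:
  "preadditive_category C \<Longrightarrow> preadditive_category (opposite C)"
  unfolding preadditive_category_def preadditive_category_axioms_def
  by (simp add: category_opposite)

text \<open>Passing to the opposite exchanges the kernel axioms with the cokernel axioms and monic
  with epic normality. Dual statements are then obtained by interpreting a locale at
  \<open>opposite C\<close>.\<close>

lemma abelian_category_opposite: "abelian_category C \<Longrightarrow> abelian_category (opposite C)"
  unfolding abelian_category_def abelian_category_axioms_def
  by (simp add: preadditive_category_opposite)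

section \<open>Preadditive categories\<close>

context category
begin

lemma Arr_Hom: "f \<in> Arr C \<Longrightarrow> f \<in> Hom C (Dom C f) (Cod C f)"
  by (simp add: Hom_def)

lemma HomD:
  assumes "f \<in> Hom C X Y"
  shows "f \<in> Arr C" "Dom C f = X" "Cod C f = Y" "X \<in> Ob C" "Y \<in> Ob C"
  using assms Dom_in_Ob Cod_in_Ob by (auto simp: Hom_def)

lemma monicD:
  "\<lbrakk>monic C m; m \<in> Hom C Y Z; f \<in> Hom C X Y; g \<in> Hom C X Y; m \<cdot> f = m \<cdot> g\<rbrakk> \<Longrightarrow> f = g"
  by (auto simp: monic_def dest: HomD)

lemma epicD:
  "\<lbrakk>epic C e; e \<in> Hom C X Y; f \<in> Hom C Y Z; g \<in> Hom C Y Z; f \<cdot> e = g \<cdot> e\<rbrakk> \<Longrightarrow> f = g"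
  by (auto simp: epic_def dest: HomD)

lemma iso_arrow_iff:
  "f \<in> Hom C X Y \<Longrightarrow>
     iso_arrow C f \<longleftrightarrow> (\<exists>g\<in>Hom C Y X. g \<cdot> f = Id C X \<and> f \<cdot> g = Id C Y)"
  by (auto simp: iso_arrow_def dest: HomD)

end

context preadditive_category
begin

section \<open>Arithmetic in the Hom groups\<close>

lemma Zero_in_Hom: "\<lbrakk>X \<in> Ob C; Y \<in> Ob C\<rbrakk> \<Longrightarrow> Zero C X Y \<in> Hom C X Y"
  using monoid.one_closed[of "Hom_group C X Y"] Hom_comm_group[of X Y]
  by (simp add: comm_group_def comm_monoid_def Hom_group_def)

lemma Plus_in_Hom: "\<lbrakk>f \<in> Hom C X Y; g \<in> Hom C X Y\<rbrakk> \<Longrightarrow> Plus C f g \<in> Hom C X Y"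
  using monoid.m_closed[of "Hom_group C X Y" f g] Hom_comm_group[of X Y]
  by (auto simp: comm_group_def comm_monoid_def Hom_group_def dest: HomD)

lemma Plus_Zero: "f \<in> Hom C X Y \<Longrightarrow> Plus C f (Zero C X Y) = f"
  using monoid.r_one[of "Hom_group C X Y" f] Hom_comm_group[of X Y]
  by (auto simp: comm_group_def comm_monoid_def Hom_group_def dest: HomD)

lemma Zero_Plus: "f \<in> Hom C X Y \<Longrightarrow> Plus C (Zero C X Y) f = f"
  using monoid.l_one[of "Hom_group C X Y" f] Hom_comm_group[of X Y]
  by (auto simp: comm_group_def comm_monoid_def Hom_group_def dest: HomD)

lemma Plus_cancel:
  assumes "f \<in> Hom C X Y" "g \<in> Hom C X Y" "h \<in> Hom C X Y"
  shows "Plus C f g = Plus C f h \<longleftrightarrow> g = h"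
proof -
  have G: "Group.group (Hom_group C X Y)"
    using Hom_comm_group[of X Y] assms(1) by (auto simp: comm_group_def dest: HomD)
  from monoid.Units_l_cancel[OF group.is_monoid[OF G], of f g h] group.Units_eq[OF G] assms
  show ?thesis by (auto simp: Hom_group_def)
qed

text \<open>Subtraction: the category record has no negation, so the difference of \<open>g\<close>
  and \<open>f\<close> is formed with the inverse in \<open>Hom_group\<close>.\<close>

lemma complement_exists:
  assumes "f \<in> Hom C X Y" "g \<in> Hom C X Y"
  shows "\<exists>n\<in>Hom C X Y. Plus C f n = g"
proof -
  let ?G = "Hom_group C X Y"
  have G: "Group.group ?G"
    using Hom_comm_group[of X Y] assms(1) by (auto simp: comm_group_def dest: HomD)
  have fg: "f \<in> carrier ?G" "g \<in> carrier ?G" using assms by (auto simp: Hom_group_def)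
  have "inv\<^bsub>?G\<^esub> f \<otimes>\<^bsub>?G\<^esub> g \<in> carrier ?G" "f \<otimes>\<^bsub>?G\<^esub> (inv\<^bsub>?G\<^esub> f \<otimes>\<^bsub>?G\<^esub> g) = g"
    using G fg by (simp_all add: group.is_monoid group.inv_closed monoid.m_closed
        group.r_inv monoid.l_one flip: monoid.m_assoc)
  then show ?thesis by (auto simp: Hom_group_def)
qed

text \<open>By additivity the composite equals its own double, and cancellation makes it
  zero.\<close>

lemma Comp_Zero:
  assumes h: "h \<in> Hom C Y Z" and X: "X \<in> Ob C"
  shows "h \<cdot> Zero C X Y = Zero C X Z"
proof -
  have 0: "Zero C X Y \<in> Hom C X Y" "Zero C X Z \<in> Hom C X Z"
    using h X by (auto intro: Zero_in_Hom dest: HomD)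
  have h0: "h \<cdot> Zero C X Y \<in> Hom C X Z" using Comp_in_Hom[OF h 0(1)] .
  have "Plus C (h \<cdot> Zero C X Y) (h \<cdot> Zero C X Y) = h \<cdot> Zero C X Y"
    using Comp_Plus[OF h 0(1) 0(1)] Plus_Zero[OF 0(1)] by simp
  also have "\<dots> = Plus C (h \<cdot> Zero C X Y) (Zero C X Z)"
    using Plus_Zero[OF h0] by simp
  finally show ?thesis using Plus_cancel[OF h0 h0 0(2)] by simp
qed

lemma Zero_Comp:
  assumes "h \<in> Hom C X Y" "Z \<in> Ob C"
  shows "Zero C Y Z \<cdot> h = Zero C X Z"
proof -
  interpret op: preadditive_category "opposite C"
    by (rule preadditive_category_opposite) unfold_locales
  show ?thesis using op.Comp_Zero[of h Y X Z] assms by simp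
qed

lemma monicI:
  assumes m: "m \<in> Hom C Y Z"
    and zero: "\<And>X h. \<lbrakk>h \<in> Hom C X Y; m \<cdot> h = Zero C X Z\<rbrakk> \<Longrightarrow> h = Zero C X Y"
  shows "monic C m"
  unfolding monic_def
proof (intro conjI allI ballI impI)
  show "m \<in> Arr C" using m by (rule HomD)
  fix X f g
  assume "f \<in> Hom C X (Dom C m)" "g \<in> Hom C X (Dom C m)" and eq: "m \<cdot> f = m \<cdot> g"
  then have f: "f \<in> Hom C X Y" and g: "g \<in> Hom C X Y" using m by (auto dest: HomD)
  \<comment> \<open>\<open>n\<close> is the difference of \<open>f\<close> and \<open>g\<close>; it
    is killed by \<open>m\<close>, hence zero.\<close>
  obtain n where n: "n \<in> Hom C X Y" "Plus C g n = f" using complement_exists[OF g f] by blast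
  have mg: "m \<cdot> g \<in> Hom C X Z" and mn: "m \<cdot> n \<in> Hom C X Z"
    using Comp_in_Hom[OF m] g n by auto
  have "Plus C (m \<cdot> g) (m \<cdot> n) = Plus C (m \<cdot> g) (Zero C X Z)"
    using Comp_Plus[OF m g n(1)] n(2) eq Plus_Zero[OF mg] by simp
  then have "m \<cdot> n = Zero C X Z"
    using Plus_cancel[OF mg mn] Zero_in_Hom[of X Z] mg by (auto dest: HomD)
  then have "n = Zero C X Y" using zero n(1) by blast
  then show "f = g" using n(2) Plus_Zero[OF g] by simp
qed

lemma epicI:
  assumes "e \<in> Hom C X Y"
    and "\<And>Z h. \<lbrakk>h \<in> Hom C Y Z; h \<cdot> e = Zero C X Z\<rbrakk> \<Longrightarrow> h = Zero C Y Z"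
  shows "epic C e"
proof -
  interpret op: preadditive_category "opposite C"
    by (rule preadditive_category_opposite) unfold_locales
  show ?thesis using op.monicI[of e Y X] assms by simp
qed

lemma monic_zeroD:
  assumes "monic C m" "m \<in> Hom C Y Z" "h \<in> Hom C X Y" "m \<cdot> h = Zero C X Z"
  shows "h = Zero C X Y"
  using monicD[OF assms(1-3) Zero_in_Hom] Comp_Zero[OF assms(2)] assms(2-4)
  by (auto dest: HomD)

lemma epic_zeroD:
  assumes "epic C e" "e \<in> Hom C X Y" "h \<in> Hom C Y Z" "h \<cdot> e = Zero C X Z"
  shows "h = Zero C Y Z"
  using epicD[OF assms(1-3) Zero_in_Hom] Zero_Comp[OF assms(2)] assms(2-4)
  by (auto dest: HomD)

text \<open>Trades the unique factorization in \<open>is_kernel\<close> for monicity plus mere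
  existence of factorizations, the form in which kernels are used from here on.
  \<open>is_kernelI\<close> goes the other way.\<close>

lemma kernelE:
  assumes ker: "is_kernel C k f" and f: "f \<in> Hom C X Y"
  obtains K where "k \<in> Hom C K X" "f \<cdot> k = Zero C K Y" "monic C k"
    "\<And>W h. \<lbrakk>h \<in> Hom C W X; f \<cdot> h = Zero C W Y\<rbrakk> \<Longrightarrow> \<exists>u\<in>Hom C W K. k \<cdot> u = h"
proof -
  note k' = ker[unfolded is_kernel_def HomD(2,3)[OF f]]
  have k: "k \<in> Hom C (Dom C k) X" and fk: "f \<cdot> k = Zero C (Dom C k) Y"
    using k' by (simp_all add: Hom_def)
  have univ: "\<exists>!u. u \<in> Hom C W (Dom C k) \<and> k \<cdot> u = h"
    if "h \<in> Hom C W X" "f \<cdot> h = Zero C W Y" for W h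
    using k' that by blast
  have "monic C k"
  proof (rule monicI[OF k])
    fix W h
    assume h: "h \<in> Hom C W (Dom C k)" and 0: "k \<cdot> h = Zero C W X"
    have W: "W \<in> Ob C" "Dom C k \<in> Ob C" "X \<in> Ob C" using h k by (auto dest: HomD)
    \<comment> \<open>Both \<open>h\<close> and the zero arrow factor the zero arrow through
      \<open>k\<close>, so uniqueness identifies them.\<close>
    have "k \<cdot> Zero C W (Dom C k) = Zero C W X" "f \<cdot> Zero C W X = Zero C W Y"
      using Comp_Zero k f W by auto
    then show "h = Zero C W (Dom C k)"
      using univ[of "Zero C W X" W] Zero_in_Hom W h 0 by blast
  qed
  then show ?thesis using that k fk univ by blast
qed

lemma cokernelE:
  assumes "is_cokernel C q f" "f \<in> Hom C X Y"
  obtains Q where "q \<in> Hom C Y Q" "q \<cdot> f = Zero C X Q" "epic C q"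
    "\<And>W h. \<lbrakk>h \<in> Hom C Y W; h \<cdot> f = Zero C X W\<rbrakk> \<Longrightarrow> \<exists>u\<in>Hom C Q W. u \<cdot> q = h"
proof -
  interpret op: preadditive_category "opposite C"
    by (rule preadditive_category_opposite) unfold_locales
  show ?thesis
    by (rule op.kernelE[of q f Y X, unfolded is_kernel_opposite monic_opposite Hom_opposite
          opposite_simps, OF assms]) (rule that)
qed

lemma is_kernelI:
  assumes f: "f \<in> Hom C X Y" and k: "k \<in> Hom C K X" "monic C k" "f \<cdot> k = Zero C K Y"
    and univ: "\<And>W h. \<lbrakk>h \<in> Hom C W X; f \<cdot> h = Zero C W Y\<rbrakk> \<Longrightarrow> \<exists>u\<in>Hom C W K. k \<cdot> u = h"
  shows "is_kernel C k f"
proof -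
  have "\<exists>!u. u \<in> Hom C W K \<and> k \<cdot> u = h" if "h \<in> Hom C W X" "f \<cdot> h = Zero C W Y" for W h
    using univ[OF that] monicD[OF k(2,1)] by blast
  then show ?thesis
    using HomD[OF f] HomD[OF k(1)] k(3) unfolding is_kernel_def by simp
qed

lemma zero_object_Hom:
  assumes Z: "zero_object C Z"
  shows "f \<in> Hom C X Z \<Longrightarrow> f = Zero C X Z" "f \<in> Hom C Z X \<Longrightarrow> f = Zero C Z X"
proof -
  have ZO: "Z \<in> Ob C" and
    uniq: "\<And>Y. Y \<in> Ob C \<Longrightarrow> (\<exists>!f. f \<in> Hom C Y Z) \<and> (\<exists>!f. f \<in> Hom C Z Y)"
    using Z by (simp_all add: zero_object_def)
  show "f = Zero C X Z" if f: "f \<in> Hom C X Z"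
    using uniq[of X] f Zero_in_Hom[OF _ ZO, of X] HomD(4)[OF f] by blast
  show "f = Zero C Z X" if f: "f \<in> Hom C Z X"
    using uniq[of X] f Zero_in_Hom[OF ZO, of X] HomD(5)[OF f] by blast
qed

text \<open>Every arrow into or out of \<open>Z\<close> absorbs the identity of \<open>Z\<close>,
  which is zero.\<close>

lemma zero_objectI:
  assumes Z: "Z \<in> Ob C" and id: "Id C Z = Zero C Z Z"
  shows "zero_object C Z"
proof -
  have "f = Zero C X Z" if "f \<in> Hom C X Z" for f X
    using Id_Comp[OF that] Zero_Comp[OF that Z] id by simp
  moreover have "f = Zero C Z X" if "f \<in> Hom C Z X" for f X
    using Comp_Id[OF that] Comp_Zero[OF that Z] id by simp
  ultimately show ?thesis
    using Z Zero_in_Hom unfolding zero_object_def by blast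
qed

text \<open>Makes every object a direct summand of itself, which later places \<open>S\<close> in
  \<open>Add C S\<close>.\<close>

lemma biproduct_Zero:
  assumes X: "X \<in> Ob C" and Z: "zero_object C Z"
  shows "biproduct C X Z X"
proof -
  have ZO: "Z \<in> Ob C" using Z by (simp add: zero_object_def)
  note in_Hom = Id_in_Hom[OF X] Zero_in_Hom[OF X ZO] Zero_in_Hom[OF ZO X]
  have "Id C Z = Zero C Z Z" using zero_object_Hom(1)[OF Z Id_in_Hom[OF ZO]] .
  then have "Id C X \<cdot> Id C X = Id C X" "Zero C X Z \<cdot> Zero C Z X = Id C Z"
    "Zero C X Z \<cdot> Id C X = Zero C X Z" "Id C X \<cdot> Zero C Z X = Zero C Z X"
    "Plus C (Id C X \<cdot> Id C X) (Zero C Z X \<cdot> Zero C X Z) = Id C X"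
    using Id_Comp[OF in_Hom(1)] Comp_Zero[OF in_Hom(2) ZO] Comp_Id[OF in_Hom(2)]
      Id_Comp[OF in_Hom(3)] Comp_Zero[OF in_Hom(3) X] Plus_Zero[OF in_Hom(1)] by simp_all
  then show ?thesis
    unfolding biproduct_def using X ZO in_Hom by blast
qed

section \<open>Injective objects\<close>

lemma injective_biproduct:
  assumes X: "injective_object C X" and Y: "injective_object C Y" and bi: "biproduct C X Y Z"
  shows "injective_object C Z"
  unfolding injective_object_def
proof (intro conjI allI impI ballI)
  show "Z \<in> Ob C" using bi by (simp add: biproduct_def)
  obtain i j p q where ij: "i \<in> Hom C X Z" "j \<in> Hom C Y Z" "p \<in> Hom C Z X" "q \<in> Hom C Z Y"
    and sum: "Plus C (i \<cdot> p) (j \<cdot> q) = Id C Z"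
    using bi by (auto simp: biproduct_def)
  fix m f
  assume m: "monic C m" and f: "f \<in> Hom C (Dom C m) Z"
  have mH: "m \<in> Hom C (Dom C m) (Cod C m)" using m by (simp add: monic_def Arr_Hom)
  \<comment> \<open>The two components of \<open>f\<close> are extended separately and reassembled
    with \<open>i\<close> and \<open>j\<close>.\<close>
  obtain g h where g: "g \<in> Hom C (Cod C m) X" "g \<cdot> m = p \<cdot> f"
    and h: "h \<in> Hom C (Cod C m) Y" "h \<cdot> m = q \<cdot> f"
    using X Y m Comp_in_Hom[OF ij(3) f] Comp_in_Hom[OF ij(4) f]
    unfolding injective_object_def by blast
  have ig: "i \<cdot> g \<in> Hom C (Cod C m) Z" and jh: "j \<cdot> h \<in> Hom C (Cod C m) Z"
    using Comp_in_Hom ij g h by auto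
  have "Plus C (i \<cdot> g) (j \<cdot> h) \<cdot> m = Plus C (i \<cdot> (p \<cdot> f)) (j \<cdot> (q \<cdot> f))"
    using Plus_Comp[OF ig jh mH] Comp_assoc[OF ij(1) g(1) mH] Comp_assoc[OF ij(2) h(1) mH] g h
    by simp
  also have "\<dots> = Plus C (i \<cdot> p) (j \<cdot> q) \<cdot> f"
    using Plus_Comp[OF _ _ f, of "i \<cdot> p" Z "j \<cdot> q"] Comp_in_Hom[OF ij(1,3)]
      Comp_in_Hom[OF ij(2,4)] Comp_assoc[OF ij(1,3) f] Comp_assoc[OF ij(2,4) f] by simp
  also have "\<dots> = f" using sum Id_Comp[OF f] by simp
  finally show "\<exists>g\<in>Hom C (Cod C m) Z. g \<cdot> m = f"
    using Plus_in_Hom[OF ig jh] by blast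
qed

text \<open>Extend into the larger object \<open>Z\<close>, then project back to the
  summand.\<close>

lemma injective_summand:
  assumes Z: "injective_object C Z" and bi: "biproduct C X Y Z"
  shows "injective_object C X"
  unfolding injective_object_def
proof (intro conjI allI impI ballI)
  show "X \<in> Ob C" using bi by (simp add: biproduct_def)
  obtain i p where ip: "i \<in> Hom C X Z" "p \<in> Hom C Z X" "p \<cdot> i = Id C X"
    using bi by (auto simp: biproduct_def)
  fix m f
  assume m: "monic C m" and f: "f \<in> Hom C (Dom C m) X"
  have mH: "m \<in> Hom C (Dom C m) (Cod C m)" using m by (simp add: monic_def Arr_Hom)
  obtain g where g: "g \<in> Hom C (Cod C m) Z" "g \<cdot> m = i \<cdot> f"
    using Z m Comp_in_Hom[OF ip(1) f] unfolding injective_object_def by blast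
  have "(p \<cdot> g) \<cdot> m = f"
    using Comp_assoc[OF ip(2) g(1) mH] Comp_assoc[OF ip(2,1) f] g ip(3) Id_Comp[OF f] by simp
  then show "\<exists>g\<in>Hom C (Cod C m) X. g \<cdot> m = f"
    using Comp_in_Hom[OF ip(2) g(1)] by blast
qed

section \<open>Short exact sequences\<close>

lemma short_exact_Ob:
  assumes "short_exact C i p"
  shows "Dom C i \<in> Ob C" "Cod C i \<in> Ob C" "Cod C p \<in> Ob C"
  using assms Dom_in_Ob Cod_in_Ob by (simp_all add: short_exact_def is_kernel_def)

lemma short_exactE:
  assumes "short_exact C i p"
  obtains "i \<in> Hom C (Dom C i) (Cod C i)" "p \<in> Hom C (Cod C i) (Cod C p)"
    "p \<cdot> i = Zero C (Dom C i) (Cod C p)" "monic C i" "epic C p"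
    "\<And>W h. \<lbrakk>h \<in> Hom C W (Cod C i); p \<cdot> h = Zero C W (Cod C p)\<rbrakk>
       \<Longrightarrow> \<exists>u\<in>Hom C W (Dom C i). i \<cdot> u = h"
    "\<And>W h. \<lbrakk>h \<in> Hom C (Cod C i) W; h \<cdot> i = Zero C (Dom C i) W\<rbrakk>
       \<Longrightarrow> \<exists>u\<in>Hom C (Cod C p) W. u \<cdot> p = h"
proof -
  have i: "i \<in> Hom C (Dom C i) (Cod C i)" and p: "p \<in> Hom C (Cod C i) (Cod C p)"
    using assms by (simp_all add: short_exact_def is_kernel_def Hom_def)
  obtain K where "i \<in> Hom C K (Cod C i)" "p \<cdot> i = Zero C K (Cod C p)" "monic C i"
    "\<And>W h. \<lbrakk>h \<in> Hom C W (Cod C i); p \<cdot> h = Zero C W (Cod C p)\<rbrakk> \<Longrightarrow> \<exists>u\<in>Hom C W K. i \<cdot> u = h"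
    using kernelE[OF _ p] assms by (metis short_exact_def)
  moreover obtain Q where "p \<in> Hom C (Cod C i) Q" "epic C p"
    "\<And>W h. \<lbrakk>h \<in> Hom C (Cod C i) W; h \<cdot> i = Zero C (Dom C i) W\<rbrakk> \<Longrightarrow> \<exists>u\<in>Hom C Q W. u \<cdot> p = h"
    using cokernelE[OF _ i] assms by (metis short_exact_def)
  moreover have "K = Dom C i" "Q = Cod C p" using calculation by (auto dest: HomD)
  ultimately show ?thesis using that[OF i p] by blast
qed

text \<open>Injectivity extends the identity of the left end to a retraction \<open>r\<close> of
  \<open>i\<close>. The arrow 1 - \<open>i \<cdot> r\<close> kills \<open>i\<close>, so it descends
  along \<open>p\<close> to a section \<open>s\<close>, and \<open>i\<close>, \<open>s\<close>,
  \<open>r\<close>, \<open>p\<close> form the biproduct.\<close>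

lemma short_exact_split:
  assumes se: "short_exact C i p" and inj: "injective_object C (Dom C i)"
  shows "biproduct C (Dom C i) (Cod C p) (Cod C i)"
proof (rule short_exactE[OF se])
  let ?X = "Dom C i" and ?E = "Cod C i" and ?Y = "Cod C p"
  assume i: "i \<in> Hom C ?X ?E" and p: "p \<in> Hom C ?E ?Y" and pi: "p \<cdot> i = Zero C ?X ?Y"
    and mon: "monic C i" and epi: "epic C p"
    and coker: "\<And>W h. \<lbrakk>h \<in> Hom C ?E W; h \<cdot> i = Zero C ?X W\<rbrakk> \<Longrightarrow> \<exists>u\<in>Hom C ?Y W. u \<cdot> p = h"
  have X: "?X \<in> Ob C" and E: "?E \<in> Ob C" and Y: "?Y \<in> Ob C" using i p by (auto dest: HomD)
  note ids = Id_in_Hom[OF X] Id_in_Hom[OF E] Id_in_Hom[OF Y]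
  obtain r where r: "r \<in> Hom C ?E ?X" "r \<cdot> i = Id C ?X"
    using inj mon ids(1) unfolding injective_object_def by blast
  have ir: "i \<cdot> r \<in> Hom C ?E ?E" using Comp_in_Hom i r by blast
  \<comment> \<open>\<open>n\<close> stands for 1 - \<open>i \<cdot> r\<close>.\<close>
  obtain n where n: "n \<in> Hom C ?E ?E" "Plus C (i \<cdot> r) n = Id C ?E"
    using complement_exists[OF ir ids(2)] by blast
  have ni: "n \<cdot> i \<in> Hom C ?X ?E" and pn: "p \<cdot> n \<in> Hom C ?E ?Y" and rn: "r \<cdot> n \<in> Hom C ?E ?X"
    using Comp_in_Hom n i p r by auto
  have "Plus C i (n \<cdot> i) = Plus C i (Zero C ?X ?E)"
    using Plus_Comp[OF ir n(1) i] n(2) Id_Comp[OF i] Comp_assoc[OF i r(1) i] r(2) Comp_Id[OF i]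
      Plus_Zero[OF i] by simp
  then have "n \<cdot> i = Zero C ?X ?E"
    using Plus_cancel[OF i ni Zero_in_Hom[OF X E]] by simp
  then obtain s where s: "s \<in> Hom C ?Y ?E" "s \<cdot> p = n" using coker[OF n(1)] by blast
  \<comment> \<open>Since \<open>p \<cdot> i\<close> is zero, subtracting \<open>i \<cdot> r\<close>
    from the identity is invisible to \<open>p\<close>; cancelling the epic \<open>p\<close> on the
    right then gives the section property.\<close>
  have "p \<cdot> n = p"
    using Comp_Plus[OF p ir n(1)] n(2) Comp_Id[OF p] Comp_assoc[OF p i r(1)] pi
      Zero_Comp[OF r(1) Y] Zero_Plus[OF pn] by simp
  then have "(p \<cdot> s) \<cdot> p = Id C ?Y \<cdot> p"
    using Comp_assoc[OF p s(1) p] s(2) Id_Comp[OF p] by simp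
  then have ps: "p \<cdot> s = Id C ?Y"
    using epicD[OF epi p Comp_in_Hom[OF p s(1)] ids(3)] by blast
  have "Plus C r (r \<cdot> n) = Plus C r (Zero C ?E ?X)"
    using Comp_Plus[OF r(1) ir n(1)] n(2) Comp_Id[OF r(1)] Comp_assoc[OF r(1) i r(1)] r(2)
      Id_Comp[OF r(1)] Plus_Zero[OF r(1)] by simp
  then have "r \<cdot> n = Zero C ?E ?X"
    using Plus_cancel[OF r(1) rn Zero_in_Hom[OF E X]] by simp
  then have "r \<cdot> s = Zero C ?Y ?X"
    using epic_zeroD[OF epi p Comp_in_Hom[OF r(1) s(1)]] Comp_assoc[OF r(1) s(1) p] s(2) by simp
  then show ?thesis
    unfolding biproduct_def using X Y E i p r s ps pi n(2) by blast
qed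

end

section \<open>Abelian categories\<close>

context abelian_category
begin

text \<open>The monic \<open>f\<close> is the kernel of some \<open>g\<close>. Being epic, it forces
  \<open>g\<close> to be zero, so the identity of the codomain lifts through \<open>f\<close>. This
  right inverse is two-sided because \<open>f\<close> is monic.\<close>

lemma monic_epic_iso:
  assumes m: "monic C f" and e: "epic C f"
  shows "iso_arrow C f"
proof -
  obtain g where g: "is_kernel C f g" using monic_normal[OF m] by blast
  have fH: "f \<in> Hom C (Dom C f) (Cod C f)" using m by (simp add: monic_def Arr_Hom)
  have Y: "Cod C f \<in> Ob C" using HomD(5)[OF fH] .
  have gH: "g \<in> Hom C (Cod C f) (Cod C g)" using g by (simp add: is_kernel_def Hom_def)
  obtain K where K: "f \<in> Hom C K (Cod C f)" "g \<cdot> f = Zero C K (Cod C g)" "monic C f"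
    and ker: "\<And>W h. \<lbrakk>h \<in> Hom C W (Cod C f); g \<cdot> h = Zero C W (Cod C g)\<rbrakk>
      \<Longrightarrow> \<exists>u\<in>Hom C W K. f \<cdot> u = h"
    by (rule kernelE[OF g gH]) (rule that)
  have [simp]: "K = Dom C f" using HomD(2)[OF K(1)] by simp
  have "g = Zero C (Cod C f) (Cod C g)" using epic_zeroD[OF e K(1) gH K(2)] .
  then have "g \<cdot> Id C (Cod C f) = Zero C (Cod C f) (Cod C g)"
    using Comp_Id[OF gH] by simp
  then obtain u where u: "u \<in> Hom C (Cod C f) (Dom C f)" "f \<cdot> u = Id C (Cod C f)"
    using ker[OF Id_in_Hom[OF Y]] by auto
  have "f \<cdot> (u \<cdot> f) = f \<cdot> Id C (Dom C f)"
    using Comp_assoc[OF fH u(1) fH] u(2) Id_Comp[OF fH] Comp_Id[OF fH] by simp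
  then have "u \<cdot> f = Id C (Dom C f)"
    using monicD[OF m fH Comp_in_Hom[OF u(1) fH] Id_in_Hom] HomD(4)[OF fH] by blast
  then show ?thesis using iso_arrow_iff[OF fH] u by blast
qed

text \<open>An epic is the cokernel of some \<open>f\<close>, and \<open>f\<close> factors through
  the kernel \<open>k\<close>. Whatever kills \<open>k\<close> therefore kills \<open>f\<close> and
  descends along \<open>e\<close>, so \<open>e\<close> is also the cokernel of
  \<open>k\<close>.\<close>

lemma short_exact_kernel:
  assumes e: "epic C e" and k: "is_kernel C k e"
  shows "short_exact C k e"
proof -
  interpret op: preadditive_category "opposite C"
    by (rule preadditive_category_opposite) unfold_locales
  have eH: "e \<in> Hom C (Dom C e) (Cod C e)" using e by (simp add: epic_def Arr_Hom)
  obtain K where kH: "k \<in> Hom C K (Dom C e)" "e \<cdot> k = Zero C K (Cod C e)" "monic C k"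
    and ker: "\<And>W h. \<lbrakk>h \<in> Hom C W (Dom C e); e \<cdot> h = Zero C W (Cod C e)\<rbrakk>
      \<Longrightarrow> \<exists>u\<in>Hom C W K. k \<cdot> u = h"
    by (rule kernelE[OF k eH]) (rule that)
  obtain f where f: "is_cokernel C e f" using epic_normal[OF e] by blast
  then have fH: "f \<in> Hom C (Dom C f) (Dom C e)" by (simp add: is_cokernel_def Hom_def)
  obtain Q where Q: "e \<in> Hom C (Dom C e) Q" and ef: "e \<cdot> f = Zero C (Dom C f) Q" "epic C e"
    and coker: "\<And>W h. \<lbrakk>h \<in> Hom C (Dom C e) W; h \<cdot> f = Zero C (Dom C f) W\<rbrakk>
      \<Longrightarrow> \<exists>u\<in>Hom C Q W. u \<cdot> e = h"
    by (rule cokernelE[OF f fH]) (rule that)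
  have [simp]: "Q = Cod C e" using HomD(3)[OF Q] by simp
  obtain v where v: "v \<in> Hom C (Dom C f) K" "k \<cdot> v = f" using ker[OF fH] ef by auto
  have "\<exists>u\<in>Hom C (Cod C e) W. u \<cdot> e = h" if h: "h \<in> Hom C (Dom C e) W" "h \<cdot> k = Zero C K W" for W h
  proof -
    have "h \<cdot> f = Zero C (Dom C f) W"
      using Comp_assoc[OF h(1) kH(1) v(1)] v h(2) Zero_Comp[OF v(1) HomD(5)[OF h(1)]] by simp
    then show ?thesis using coker[OF h(1)] by simp
  qed
  then have "is_cokernel C e k"
    using op.is_kernelI[of k "Dom C e" K e "Cod C e"] eH kH e by simp
  then show ?thesis using k by (simp add: short_exact_def)
qed

section \<open>Simple objects and Schur's lemma\<close>

lemma simple_nonzero_epic: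
  assumes S: "simple_object C S" and f: "f \<in> Hom C X S" and nz: "f \<noteq> Zero C X S"
  shows "epic C f"
proof -
  obtain c where c: "is_cokernel C c f" using cokernel_exists HomD(1)[OF f] by blast
  obtain W where cH: "c \<in> Hom C S W" "c \<cdot> f = Zero C X W" "epic C c"
    and coker: "\<And>V h. \<lbrakk>h \<in> Hom C S V; h \<cdot> f = Zero C X V\<rbrakk> \<Longrightarrow> \<exists>u\<in>Hom C W V. u \<cdot> c = h"
    by (rule cokernelE[OF c f]) (rule that)
  \<comment> \<open>\<open>m\<close> is the image of \<open>f\<close>, built as the kernel of its
    cokernel. It is nonzero because \<open>f\<close> factors through it, so simplicity makes it an
    isomorphism and the cokernel \<open>c\<close> vanishes.\<close>
  obtain m where m: "is_kernel C m c" using kernel_exists HomD(1)[OF cH(1)] by blast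
  obtain K where mH: "m \<in> Hom C K S" "c \<cdot> m = Zero C K W" "monic C m"
    and ker: "\<And>V h. \<lbrakk>h \<in> Hom C V S; c \<cdot> h = Zero C V W\<rbrakk> \<Longrightarrow> \<exists>u\<in>Hom C V K. m \<cdot> u = h"
    by (rule kernelE[OF m cH(1)]) (rule that)
  obtain u where u: "u \<in> Hom C X K" "m \<cdot> u = f" using ker[OF f cH(2)] by blast
  have Ob: "X \<in> Ob C" "S \<in> Ob C" "W \<in> Ob C" using f cH by (auto dest: HomD)
  have "\<not> zero_object C K"
    using zero_object_Hom(1)[of K u X] u Comp_Zero[OF mH(1) Ob(1)] nz by auto
  then have "iso_arrow C m"
    using S mH HomD(2,3)[OF mH(1)] unfolding simple_object_def by metis
  then obtain g where g: "g \<in> Hom C S K" "m \<cdot> g = Id C S"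
    using iso_arrow_iff[OF mH(1)] by blast
  have "c = Zero C S W"
    using Comp_assoc[OF cH(1) mH(1) g(1)] g(2) Comp_Id[OF cH(1)] mH(2) Zero_Comp[OF g(1) Ob(3)]
    by simp
  show ?thesis
  proof (rule epicI[OF f])
    fix Z h
    assume h: "h \<in> Hom C S Z" "h \<cdot> f = Zero C X Z"
    then obtain v where "v \<in> Hom C W Z" "v \<cdot> c = h" using coker by blast
    then show "h = Zero C S Z" using \<open>c = Zero C S W\<close> Comp_Zero Ob by metis
  qed
qed

text \<open>\<open>simple_object\<close> constrains subobjects, while its dual constrains quotients.
  The kernel of a quotient of \<open>S\<close> is either zero, making the quotient map an
  isomorphism, or all of \<open>S\<close>, making the quotient zero.\<close>

lemma simple_object_opposite:
  assumes S: "simple_object C S"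
  shows "simple_object (opposite C) S"
proof -
  have "zero_object C (Cod C e) \<or> iso_arrow C e" if e: "epic C e" and dom: "Dom C e = S" for e
  proof -
    have eH: "e \<in> Hom C S (Cod C e)" using e dom Arr_Hom[of e] by (simp add: epic_def)
    obtain k where k: "is_kernel C k e" using kernel_exists HomD(1)[OF eH] by blast
    obtain K where kH: "k \<in> Hom C K S" "e \<cdot> k = Zero C K (Cod C e)" "monic C k"
      and ker: "\<And>V h. \<lbrakk>h \<in> Hom C V S; e \<cdot> h = Zero C V (Cod C e)\<rbrakk> \<Longrightarrow> \<exists>u\<in>Hom C V K. k \<cdot> u = h"
      by (rule kernelE[OF k eH]) (rule that)
    have Ob: "S \<in> Ob C" "Cod C e \<in> Ob C" using eH by (auto dest: HomD)
    have "zero_object C K \<or> iso_arrow C k"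
      using S kH HomD(2,3)[OF kH(1)] unfolding simple_object_def by metis
    then show ?thesis
    proof
      assume K: "zero_object C K"
      have "monic C e"
      proof (rule monicI[OF eH])
        fix V h
        assume h: "h \<in> Hom C V S" "e \<cdot> h = Zero C V (Cod C e)"
        then obtain u where u: "u \<in> Hom C V K" "k \<cdot> u = h" using ker by blast
        then show "h = Zero C V S"
          using zero_object_Hom(1)[OF K u(1)] Comp_Zero[OF kH(1)] HomD(4)[OF h(1)] by metis
      qed
      then show ?thesis using monic_epic_iso e by blast
    next
      assume "iso_arrow C k"
      then obtain g where g: "g \<in> Hom C S K" "k \<cdot> g = Id C S"
        using iso_arrow_iff[OF kH(1)] by blast
      have "e = Zero C S (Cod C e)"
        using Comp_assoc[OF eH kH(1) g(1)] g(2) Comp_Id[OF eH] kH(2) Zero_Comp[OF g(1) Ob(2)]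
        by simp
      then have "Id C (Cod C e) = Zero C (Cod C e) (Cod C e)"
        using epic_zeroD[OF e eH Id_in_Hom[OF Ob(2)]] Id_Comp[OF eH] by simp
      then show ?thesis using zero_objectI Ob by blast
    qed
  qed
  then show ?thesis using S by (auto simp: simple_object_def)
qed

text \<open>Schur's lemma: simplicity of the target makes \<open>f\<close> epic and, dually,
  simplicity of the source makes it monic.\<close>

lemma simple_nonzero_iso:
  assumes T: "simple_object C T" and S: "simple_object C S"
    and f: "f \<in> Hom C T S" and nz: "f \<noteq> Zero C T S"
  shows "iso_arrow C f"
proof -
  interpret op: abelian_category "opposite C"
    by (rule abelian_category_opposite) unfold_locales
  have "monic C f"
    using op.simple_nonzero_epic[OF simple_object_opposite[OF T], of f S] f nz by simp
  then show ?thesis using monic_epic_iso simple_nonzero_epic[OF S f nz] by blast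
qed

lemma iso_from_zero:
  assumes f: "f \<in> Hom C X Y" and iso: "iso_arrow C f" and zero: "f = Zero C X Y"
  shows "zero_object C X"
proof -
  obtain g where g: "g \<in> Hom C Y X" "g \<cdot> f = Id C X"
    using iso iso_arrow_iff[OF f] by blast
  have X: "X \<in> Ob C" using HomD(4)[OF f] .
  show ?thesis using zero_objectI[OF X] g Comp_Zero[OF g(1) X] zero by simp
qed

text \<open>Replaces the isomorphism test inside \<open>JH_multiplicity\<close> by vanishing of a
  Hom group. The first form serves the injective case, the second the projective one.\<close>

lemma isomorphic_simple_iff:
  assumes T: "simple_object C T" and S: "simple_object C S"
  shows "isomorphic C T S \<longleftrightarrow> \<not> Hom C T S \<subseteq> {Zero C T S}"
    and "isomorphic C T S \<longleftrightarrow> \<not> Hom C S T \<subseteq> {Zero C S T}"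
proof -
  have iso: "isomorphic C X Y \<longleftrightarrow> \<not> Hom C X Y \<subseteq> {Zero C X Y}"
    if "simple_object C X" "simple_object C Y" for X Y
  proof
    assume "isomorphic C X Y"
    then obtain f where "f \<in> Hom C X Y" "iso_arrow C f" by (auto simp: isomorphic_def)
    moreover from this have "f \<noteq> Zero C X Y"
      using iso_from_zero that(1) unfolding simple_object_def by blast
    ultimately show "\<not> Hom C X Y \<subseteq> {Zero C X Y}" by blast
  next
    assume "\<not> Hom C X Y \<subseteq> {Zero C X Y}"
    then show "isomorphic C X Y"
      using simple_nonzero_iso[OF that] unfolding isomorphic_def by blast
  qed
  have sym: "isomorphic C Y X" if "isomorphic C X Y" for X Y
  proof -
    obtain f g where f: "f \<in> Hom C X Y" and g: "g \<in> Hom C Y X" "g \<cdot> f = Id C X" "f \<cdot> g = Id C Y"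
      using \<open>isomorphic C X Y\<close> iso_arrow_iff unfolding isomorphic_def by blast
    then show ?thesis using iso_arrow_iff[OF g(1)] unfolding isomorphic_def by blast
  qed
  show "isomorphic C T S \<longleftrightarrow> \<not> Hom C T S \<subseteq> {Zero C T S}" using iso[OF T S] .
  show "isomorphic C T S \<longleftrightarrow> \<not> Hom C S T \<subseteq> {Zero C S T}" using iso[OF S T] sym by blast
qed

section \<open>Exactness of Hom and vanishing multiplicities\<close>

lemma Hom_injective_exact:
  assumes S: "injective_object C S" and se: "short_exact C i p"
  shows "Hom C (Cod C i) S \<subseteq> {Zero C (Cod C i) S} \<longleftrightarrow>
    Hom C (Dom C i) S \<subseteq> {Zero C (Dom C i) S} \<and> Hom C (Cod C p) S \<subseteq> {Zero C (Cod C p) S}"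
proof (rule short_exactE[OF se])
  let ?X = "Dom C i" and ?E = "Cod C i" and ?Y = "Cod C p"
  assume i: "i \<in> Hom C ?X ?E" and p: "p \<in> Hom C ?E ?Y"
    and mon: "monic C i" and epi: "epic C p"
    and coker: "\<And>W h. \<lbrakk>h \<in> Hom C ?E W; h \<cdot> i = Zero C ?X W\<rbrakk> \<Longrightarrow> \<exists>u\<in>Hom C ?Y W. u \<cdot> p = h"
  have SO: "S \<in> Ob C" using S by (simp add: injective_object_def)
  show ?thesis
  proof (intro iffI conjI subsetI)
    fix f
    assume E: "Hom C ?E S \<subseteq> {Zero C ?E S}" and f: "f \<in> Hom C ?X S"
    \<comment> \<open>Injectivity extends \<open>f\<close> to the middle object, where only the zero
      arrow is available.\<close>
    obtain g where "g \<in> Hom C ?E S" "g \<cdot> i = f"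
      using S mon f unfolding injective_object_def by blast
    then show "f \<in> {Zero C ?X S}" using E Zero_Comp[OF i SO] by auto
  next
    fix f
    assume E: "Hom C ?E S \<subseteq> {Zero C ?E S}" and f: "f \<in> Hom C ?Y S"
    have "f \<cdot> p = Zero C ?E S" using Comp_in_Hom[OF f p] E by blast
    then show "f \<in> {Zero C ?Y S}" using epic_zeroD[OF epi p f] by simp
  next
    fix f
    assume XY: "Hom C ?X S \<subseteq> {Zero C ?X S} \<and> Hom C ?Y S \<subseteq> {Zero C ?Y S}" and f: "f \<in> Hom C ?E S"
    have "f \<cdot> i = Zero C ?X S" using Comp_in_Hom[OF f i] XY by blast
    \<comment> \<open>An arrow that vanishes on the subobject comes from the quotient, where it must
      be zero.\<close>
    then obtain u where "u \<in> Hom C ?Y S" "u \<cdot> p = f" using coker[OF f] by blast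
    then show "f \<in> {Zero C ?E S}" using XY Zero_Comp[OF p SO] by auto
  qed
qed

lemma Hom_projective_exact:
  assumes "projective_object C S" and se: "short_exact C i p"
  shows "Hom C S (Cod C i) \<subseteq> {Zero C S (Cod C i)} \<longleftrightarrow>
    Hom C S (Dom C i) \<subseteq> {Zero C S (Dom C i)} \<and> Hom C S (Cod C p) \<subseteq> {Zero C S (Cod C p)}"
proof -
  interpret op: abelian_category "opposite C"
    by (rule abelian_category_opposite) unfold_locales
  have "Dom C p = Cod C i" using se by (simp add: short_exact_def is_kernel_def)
  then show ?thesis using op.Hom_injective_exact[of S p i] assms by auto
qed

end

text \<open>\<open>P\<close> abstracts the vanishing of an exact Hom functor; it is instantiated
  with Hom into \<open>S\<close> and with Hom out of \<open>S\<close>. Because \<open>P\<close> is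
  decided by the factors of an arbitrary composition series, the choice hidden in
  \<open>JH_multiplicity\<close> does not matter.\<close>

lemma objects_without_factor_eq:
  assumes fl: "finite_length_category C"
    and zero: "\<And>Z. zero_object C Z \<Longrightarrow> P Z"
    and exact: "\<And>i p. short_exact C i p \<Longrightarrow> P (Cod C i) \<longleftrightarrow> P (Dom C i) \<and> P (Cod C p)"
    and simple: "\<And>T. simple_object C T \<Longrightarrow> P T \<longleftrightarrow> \<not> isomorphic C T S"
  shows "objects_without_factor C S = {M \<in> Ob C. P M}"
proof -
  have series: "P M \<longleftrightarrow> card {k. k < n \<and> isomorphic C (Cod C (p k)) S} = 0"
    if cs: "composition_series C M n X j p" for M n X j p
  proof -
    \<comment> \<open>Climbing the series, stage \<open>l\<close> has exactly the factors with index
      below \<open>l\<close>.\<close>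
    have "P (X l) \<longleftrightarrow> (\<forall>k<l. \<not> isomorphic C (Cod C (p k)) S)" if "l \<le> n" for l
      using that
    proof (induction l)
      case 0
      then show ?case using cs zero by (simp add: composition_series_def)
    next
      case (Suc l)
      then have l: "j l \<in> Hom C (X l) (X (Suc l))" "short_exact C (j l) (p l)"
        "simple_object C (Cod C (p l))"
        using cs by (auto simp: composition_series_def)
      then have "P (X (Suc l)) \<longleftrightarrow> P (X l) \<and> \<not> isomorphic C (Cod C (p l)) S"
        using exact[OF l(2)] simple[OF l(3)] by (simp add: Hom_def)
      then show ?case using Suc by (auto simp: less_Suc_eq)
    qed
    from this[of n] show ?thesis using cs by (auto simp: composition_series_def)
  qed
  have "JH_multiplicity C M S = 0 \<longleftrightarrow> P M" if M: "M \<in> Ob C" for M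
  proof -
    let ?Q = "\<lambda>a. \<exists>n X j p. composition_series C M n X j p \<and>
        a = card {k. k < n \<and> isomorphic C (Cod C (p k)) S}"
    have "\<exists>a. ?Q a"
      using fl M unfolding finite_length_category_def by blast
    \<comment> \<open>Finite length supplies some series, so the chosen number is the count of an
      actual series, to which \<open>series\<close> applies.\<close>
    then have "?Q (JH_multiplicity C M S)"
      unfolding JH_multiplicity_def by (rule someI_ex)
    then show ?thesis using series by auto
  qed
  then show ?thesis by (auto simp: objects_without_factor_def)
qed

section \<open>Torsion pairs\<close>

text \<open>A reformulation of \<open>factorizing_pair\<close> suited to duality: orthogonality
  takes the place of uniqueness, and short exact sequences that of subobject classes, so that
  dualizing merely swaps the two classes. The class of subobjects comes first here, whereas
  \<open>factorizing_pair\<close> lists the class of quotients first.\<close>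

definition torsion_pair :: "('o, 'm) cat \<Rightarrow> 'o set \<Rightarrow> 'o set \<Rightarrow> bool" where
  "torsion_pair C D B \<longleftrightarrow> B \<subseteq> Ob C \<and> D \<subseteq> Ob C \<and> extension_closed C B \<and> extension_closed C D \<and>
     (\<forall>X\<in>D. \<forall>Y\<in>B. Hom C X Y \<subseteq> {Zero C X Y}) \<and>
     (\<forall>M\<in>Ob C. \<exists>m q. short_exact C m q \<and> Cod C m = M \<and> Dom C m \<in> D \<and> Cod C q \<in> B)"

lemma torsion_pair_opposite:
  assumes "torsion_pair (opposite C) D B"
  shows "torsion_pair C B D"
  unfolding torsion_pair_def
proof (intro conjI ballI)
  note tp = assms[unfolded torsion_pair_def opposite_simps extension_closed_opposite Hom_opposite
      short_exact_opposite]
  show "D \<subseteq> Ob C" "B \<subseteq> Ob C" "extension_closed C D" "extension_closed C B"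
    using tp by simp_all
  show "Hom C X Y \<subseteq> {Zero C X Y}" if "X \<in> B" "Y \<in> D" for X Y
    using tp that by simp
  fix M
  assume "M \<in> Ob C"
  moreover have "\<forall>M\<in>Ob C. \<exists>m q. short_exact C q m \<and> Dom C m = M \<and> Cod C m \<in> D \<and> Dom C q \<in> B"
    using tp by (elim conjE)
  ultimately obtain m q where m: "short_exact C q m" "Dom C m = M" "Cod C m \<in> D" "Dom C q \<in> B"
    by blast
  moreover have "Cod C q = M" using m(1,2) by (simp add: short_exact_def is_kernel_def)
  ultimately show "\<exists>m q. short_exact C m q \<and> Cod C m = M \<and> Dom C m \<in> B \<and> Cod C q \<in> D"
    by blast
qed

context abelian_category
begin

section \<open>Subobjects and the passage to factorizing pairs\<close>

lemma equiv_subobject: "equiv (monics_into C M) (subobject_equiv C M)"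
proof (rule equivI)
  show "subobject_equiv C M \<subseteq> monics_into C M \<times> monics_into C M"
    by (auto simp: subobject_equiv_def)
  show "refl_on (monics_into C M) (subobject_equiv C M)"
  proof (rule refl_onI)
    fix m
    assume m: "m \<in> monics_into C M"
    then have mH: "m \<in> Hom C (Dom C m) M" by (auto simp: monics_into_def monic_def Hom_def)
    have id: "Id C (Dom C m) \<in> Hom C (Dom C m) (Dom C m)" using Id_in_Hom HomD(4)[OF mH] by blast
    then have "iso_arrow C (Id C (Dom C m))" using iso_arrow_iff[OF id] Id_Comp[OF id] by blast
    then show "(m, m) \<in> subobject_equiv C M"
      using m id Comp_Id[OF mH] by (auto simp: subobject_equiv_def)
  qed
  show "sym (subobject_equiv C M)"
  proof (rule symI)
    fix m m'
    assume "(m, m') \<in> subobject_equiv C M"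
    then obtain u where m: "m \<in> monics_into C M" "m' \<in> monics_into C M"
      and u: "u \<in> Hom C (Dom C m) (Dom C m')" "iso_arrow C u" "m' \<cdot> u = m"
      by (auto simp: subobject_equiv_def)
    obtain v where v: "v \<in> Hom C (Dom C m') (Dom C m)" "v \<cdot> u = Id C (Dom C m)"
      "u \<cdot> v = Id C (Dom C m')"
      using u iso_arrow_iff by blast
    have mH: "m' \<in> Hom C (Dom C m') M" using m by (auto simp: monics_into_def monic_def Hom_def)
    have "m \<cdot> v = m'" using Comp_assoc[OF mH u(1) v(1)] u(3) v(3) Comp_Id[OF mH] by simp
    moreover have "iso_arrow C v" using iso_arrow_iff[OF v(1)] u v by blast
    ultimately show "(m', m) \<in> subobject_equiv C M" using m v by (auto simp: subobject_equiv_def)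
  qed
  show "trans (subobject_equiv C M)"
  proof (rule transI)
    fix a b c
    assume "(a, b) \<in> subobject_equiv C M" "(b, c) \<in> subobject_equiv C M"
    then obtain u v where m: "a \<in> monics_into C M" "c \<in> monics_into C M"
      and u: "u \<in> Hom C (Dom C a) (Dom C b)" "iso_arrow C u" "b \<cdot> u = a"
      and v: "v \<in> Hom C (Dom C b) (Dom C c)" "iso_arrow C v" "c \<cdot> v = b"
      by (auto simp: subobject_equiv_def)
    obtain u' where u': "u' \<in> Hom C (Dom C b) (Dom C a)" "u' \<cdot> u = Id C (Dom C a)"
      "u \<cdot> u' = Id C (Dom C b)"
      using u iso_arrow_iff by blast
    obtain v' where v': "v' \<in> Hom C (Dom C c) (Dom C b)" "v' \<cdot> v = Id C (Dom C b)"
      "v \<cdot> v' = Id C (Dom C c)"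
      using v iso_arrow_iff by blast
    have cH: "c \<in> Hom C (Dom C c) M" using m by (auto simp: monics_into_def monic_def Hom_def)
    note vu = Comp_in_Hom[OF v(1) u(1)] and uv = Comp_in_Hom[OF u'(1) v'(1)]
    have "(u' \<cdot> v') \<cdot> (v \<cdot> u) = Id C (Dom C a)"
      using Comp_assoc[OF u'(1) v'(1) vu] Comp_assoc[OF v'(1) v(1) u(1)] Id_Comp[OF u(1)] u' v'
      by simp
    moreover have "(v \<cdot> u) \<cdot> (u' \<cdot> v') = Id C (Dom C c)"
      using Comp_assoc[OF v(1) u(1) uv] Comp_assoc[OF u(1) u'(1) v'(1)] Id_Comp[OF v'(1)] u' v'
      by simp
    ultimately have "iso_arrow C (v \<cdot> u)" using iso_arrow_iff[OF vu] uv by blast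
    moreover have "c \<cdot> (v \<cdot> u) = a" using Comp_assoc[OF cH v(1) u(1)] u v by simp
    ultimately show "(a, c) \<in> subobject_equiv C M" using m vu by (auto simp: subobject_equiv_def)
  qed
qed

lemma short_exact_cokernel:
  assumes m: "monic C m" and q: "is_cokernel C q m"
  shows "short_exact C m q"
proof -
  interpret op: abelian_category "opposite C"
    by (rule abelian_category_opposite) unfold_locales
  show ?thesis using op.short_exact_kernel[of m q] assms by simp
qed

text \<open>A subobject in \<open>D\<close> maps to zero in a quotient in \<open>B\<close>, so it
  factors through the kernel of that quotient map. Two admissible subobjects thus factor through
  each other, and monicity makes the two factorizations mutually inverse.\<close>

lemma torsion_pair_factorizing:
  assumes tp: "torsion_pair C D B"
  shows "factorizing_pair C B D"
proof -
  have orth: "\<And>X Y. \<lbrakk>X \<in> D; Y \<in> B\<rbrakk> \<Longrightarrow> Hom C X Y \<subseteq> {Zero C X Y}"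
    using tp by (simp add: torsion_pair_def)
  have factors: "\<exists>u\<in>Hom C (Dom C m) (Dom C m'). m' \<cdot> u = m"
    if "monic C m" "Cod C m = Cod C m'" "Dom C m \<in> D" "short_exact C m' q'" "Cod C q' \<in> B" for m m' q'
  proof (rule short_exactE[OF that(4)])
    assume q: "q' \<in> Hom C (Cod C m') (Cod C q')"
      and ker: "\<And>W h. \<lbrakk>h \<in> Hom C W (Cod C m'); q' \<cdot> h = Zero C W (Cod C q')\<rbrakk>
       \<Longrightarrow> \<exists>u\<in>Hom C W (Dom C m'). m' \<cdot> u = h"
    have m: "m \<in> Hom C (Dom C m) (Cod C m')" using that by (auto simp: monic_def Hom_def)
    show ?thesis using ker[OF m] Comp_in_Hom[OF q m] orth[OF that(3,5)] by blast
  qed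
  have unique: "(m, m') \<in> subobject_equiv C M"
    if m: "m \<in> monics_into C M" "Dom C m \<in> D" "is_cokernel C q m" "Cod C q \<in> B"
      and m': "m' \<in> monics_into C M" "Dom C m' \<in> D" "is_cokernel C q' m'" "Cod C q' \<in> B" for M m q m' q'
  proof -
    have mono: "monic C m" "monic C m'" "Cod C m = M" "Cod C m' = M"
      using m m' by (auto simp: monics_into_def)
    note se = short_exact_cokernel[OF mono(1) m(3)] short_exact_cokernel[OF mono(2) m'(3)]
    obtain u where u: "u \<in> Hom C (Dom C m) (Dom C m')" "m' \<cdot> u = m"
      using factors[OF mono(1) _ m(2) se(2) m'(4)] mono by auto
    obtain v where v: "v \<in> Hom C (Dom C m') (Dom C m)" "m \<cdot> v = m'"
      using factors[OF mono(2) _ m'(2) se(1) m(4)] mono by auto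
    have mH: "m \<in> Hom C (Dom C m) M" "m' \<in> Hom C (Dom C m') M"
      using mono by (auto simp: monic_def Hom_def)
    have "m \<cdot> (v \<cdot> u) = m \<cdot> Id C (Dom C m)" "m' \<cdot> (u \<cdot> v) = m' \<cdot> Id C (Dom C m')"
      using Comp_assoc[OF mH(1) v(1) u(1)] Comp_assoc[OF mH(2) u(1) v(1)] u v
        Comp_Id[OF mH(1)] Comp_Id[OF mH(2)] by auto
    then have "v \<cdot> u = Id C (Dom C m)" "u \<cdot> v = Id C (Dom C m')"
      using monicD[OF mono(1) mH(1) Comp_in_Hom[OF v(1) u(1)] Id_in_Hom]
        monicD[OF mono(2) mH(2) Comp_in_Hom[OF u(1) v(1)] Id_in_Hom] HomD(4)[OF mH(1)] HomD(4)[OF mH(2)]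
      by auto
    then have "iso_arrow C u" using iso_arrow_iff[OF u(1)] v by blast
    then show ?thesis using m m' u by (auto simp: subobject_equiv_def)
  qed
  have "\<exists>!U. U \<in> subobjects C M \<and> (\<exists>m\<in>U. Dom C m \<in> D \<and> (\<exists>q. is_cokernel C q m \<and> Cod C q \<in> B))"
    if M: "M \<in> Ob C" for M
  proof -
    obtain m q where m: "short_exact C m q" "Cod C m = M" "Dom C m \<in> D" "Cod C q \<in> B"
      using tp M unfolding torsion_pair_def by blast
    have "monic C m" using m(1) by (rule short_exactE)
    then have mm: "m \<in> monics_into C M" and q: "is_cokernel C q m"
      using m(1,2) by (simp_all add: monics_into_def short_exact_def)
    have "m \<in> subobject_equiv C M `` {m}" using equiv_class_self[OF equiv_subobject mm] .
    moreover have "subobject_equiv C M `` {m} \<in> subobjects C M"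
      using mm by (auto simp: subobjects_def intro: quotientI)
    \<comment> \<open>Admissibility of a class only provides some good representative
      \<open>m'\<close>; comparing it with \<open>m\<close> is enough, since equivalent members
      force equal classes.\<close>
    moreover have "U = subobject_equiv C M `` {m}"
      if U: "U \<in> subobjects C M" "m' \<in> U" "Dom C m' \<in> D" "is_cokernel C q' m'" "Cod C q' \<in> B" for U m' q'
    proof -
      have "m' \<in> monics_into C M"
        using U in_quotient_imp_subset[OF equiv_subobject] by (auto simp: subobjects_def)
      then have "(m, m') \<in> subobject_equiv C M" using unique mm m(3,4) q U by blast
      then show ?thesis
        using U quotient_eqI[OF equiv_subobject, of U M "subobject_equiv C M `` {m}" m' m]
          \<open>m \<in> subobject_equiv C M `` {m}\<close> \<open>subobject_equiv C M `` {m} \<in> subobjects C M\<close>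
          equiv_subobject[of M] unfolding subobjects_def equiv_def sym_def by blast
    qed
    ultimately show ?thesis using m q by (intro ex1I[of _ "subobject_equiv C M `` {m}"]) blast+
  qed
  then show ?thesis using tp by (simp add: torsion_pair_def factorizing_pair_def)
qed

section \<open>Objects of \<open>Add C S\<close>\<close>

lemma Add_subset:
  "\<lbrakk>additive_full_subcategory C B; \<And>X Y. biproduct C X Y S \<Longrightarrow> X \<in> B\<rbrakk> \<Longrightarrow> Add C S \<subseteq> B"
  unfolding Add_def direct_summand_def by blast

lemma biproduct_in_Add:
  "\<lbrakk>X \<in> Add C S; Y \<in> Add C S; biproduct C X Y Z\<rbrakk> \<Longrightarrow> Z \<in> Add C S"
  unfolding Add_def additive_full_subcategory_def by blast

lemma zero_object_in_Add: "zero_object C Z \<Longrightarrow> Z \<in> Add C S"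
  unfolding Add_def additive_full_subcategory_def by blast

lemma self_in_Add:
  assumes "S \<in> Ob C"
  shows "S \<in> Add C S"
proof -
  obtain Z where "zero_object C Z" using zero_object_exists by blast
  then show ?thesis
    using biproduct_Zero[OF assms] unfolding Add_def direct_summand_def by blast
qed

lemma Add_in_Ob: "Add C S \<subseteq> Ob C"
  by (rule Add_subset) (auto simp: additive_full_subcategory_def zero_object_def biproduct_def)

lemma zero_object_injective:
  assumes Z: "zero_object C Z"
  shows "injective_object C Z"
  unfolding injective_object_def
proof (intro conjI allI impI ballI)
  show ZO: "Z \<in> Ob C" using Z by (simp add: zero_object_def)
  fix m f
  assume "monic C m" and f: "f \<in> Hom C (Dom C m) Z"
  then have m: "m \<in> Hom C (Dom C m) (Cod C m)" by (simp add: monic_def Arr_Hom)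
  have "Zero C (Cod C m) Z \<cdot> m = f"
    using Zero_Comp[OF m ZO] zero_object_Hom(1)[OF Z f] by simp
  then show "\<exists>g\<in>Hom C (Cod C m) Z. g \<cdot> m = f"
    using Zero_in_Hom[OF HomD(5)[OF m] ZO] by blast
qed

text \<open>\<open>Add_subset\<close> acts as an induction principle: injectivity holds for zero
  objects, passes to biproducts, and is inherited by the summands of \<open>S\<close>.\<close>

lemma Add_injective:
  assumes "injective_object C S"
  shows "X \<in> Add C S \<Longrightarrow> injective_object C X"
proof -
  have "Add C S \<subseteq> {X. injective_object C X}"
  proof (rule Add_subset)
    show "additive_full_subcategory C {X. injective_object C X}"
      unfolding additive_full_subcategory_def
    proof (intro conjI ballI allI impI)
      show "{X. injective_object C X} \<subseteq> Ob C"
        by (simp add: injective_object_def Collect_mono_iff subset_eq)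
      show "Z \<in> {X. injective_object C X}" if "zero_object C Z" for Z
        using zero_object_injective[OF that] by simp
      show "Z \<in> {X. injective_object C X}"
        if "X \<in> {X. injective_object C X}" "Y \<in> {X. injective_object C X}" "biproduct C X Y Z"
        for X Y Z
        using injective_biproduct[OF _ _ that(3)] that(1,2) by simp
    qed
  next
    show "X \<in> {X. injective_object C X}" if "biproduct C X Y S" for X Y
      using injective_summand[OF assms that] by simp
  qed
  then show "X \<in> Add C S \<Longrightarrow> injective_object C X" by blast
qed

text \<open>The same induction over \<open>Add C S\<close>, applied to the class of objects that
  receive only the zero arrow from \<open>M\<close>.\<close>

lemma Hom_Add_zero:
  assumes M: "M \<in> Ob C" and S: "Hom C M S \<subseteq> {Zero C M S}"
  shows "X \<in> Add C S \<Longrightarrow> Hom C M X \<subseteq> {Zero C M X}"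
proof -
  let ?B = "{X \<in> Ob C. Hom C M X \<subseteq> {Zero C M X}}"
  have "Z \<in> ?B" if XY: "X \<in> ?B" "Y \<in> ?B" and bi: "biproduct C X Y Z" for X Y Z
  proof -
    obtain i j p q where ij: "i \<in> Hom C X Z" "j \<in> Hom C Y Z" "p \<in> Hom C Z X" "q \<in> Hom C Z Y"
      and sum: "Plus C (i \<cdot> p) (j \<cdot> q) = Id C Z"
      using bi by (auto simp: biproduct_def)
    have Z: "Z \<in> Ob C" using bi by (simp add: biproduct_def)
    have "f = Zero C M Z" if f: "f \<in> Hom C M Z" for f
    proof -
      \<comment> \<open>Both components of \<open>f\<close> vanish, and \<open>f\<close> is the sum
        of their images under \<open>i\<close> and \<open>j\<close>.\<close>
      have "p \<cdot> f = Zero C M X" "q \<cdot> f = Zero C M Y"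
        using XY Comp_in_Hom[OF ij(3) f] Comp_in_Hom[OF ij(4) f] by auto
      then have "(i \<cdot> p) \<cdot> f = Zero C M Z" "(j \<cdot> q) \<cdot> f = Zero C M Z"
        using Comp_assoc[OF ij(1,3) f] Comp_assoc[OF ij(2,4) f] Comp_Zero[OF ij(1) M]
          Comp_Zero[OF ij(2) M] by auto
      then have "Id C Z \<cdot> f = Plus C (Zero C M Z) (Zero C M Z)"
        using Plus_Comp[OF Comp_in_Hom[OF ij(1,3)] Comp_in_Hom[OF ij(2,4)] f] sum by simp
      then show ?thesis using Id_Comp[OF f] Plus_Zero[OF Zero_in_Hom[OF M Z]] by simp
    qed
    then show ?thesis using Z by blast
  qed
  moreover have "Z \<in> ?B" if Z: "zero_object C Z" for Z
  proof -
    have "Hom C M Z \<subseteq> {Zero C M Z}" using zero_object_Hom(1)[OF Z] by blast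
    then show ?thesis using Z by (simp add: zero_object_def)
  qed
  ultimately have "additive_full_subcategory C ?B"
    unfolding additive_full_subcategory_def by (metis (no_types, lifting) mem_Collect_eq subsetI)
  moreover have "X \<in> ?B" if bi: "biproduct C X Y S" for X Y
  proof -
    obtain i p where ip: "i \<in> Hom C X S" "p \<in> Hom C S X" "p \<cdot> i = Id C X"
      using bi by (auto simp: biproduct_def)
    have "f = Zero C M X" if f: "f \<in> Hom C M X" for f
    proof -
      have "i \<cdot> f = Zero C M S" using S Comp_in_Hom[OF ip(1) f] by blast
      then show ?thesis
        using Comp_assoc[OF ip(2,1) f] ip(3) Id_Comp[OF f] Comp_Zero[OF ip(2) M] by simp
    qed
    then show ?thesis using HomD(4)[OF ip(1)] by blast
  qed
  ultimately have "Add C S \<subseteq> ?B" by (rule Add_subset)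
  then show "X \<in> Add C S \<Longrightarrow> Hom C M X \<subseteq> {Zero C M X}" by blast
qed

text \<open>The left end is injective, so the sequence splits and the middle object is a biproduct
  of two members.\<close>

lemma Add_extension_closed:
  assumes "injective_object C S"
  shows "extension_closed C (Add C S)"
  unfolding extension_closed_def
  using short_exact_split Add_injective[OF assms] biproduct_in_Add by blast

section \<open>Construction of the short exact sequence of an object\<close>

lemma short_exact_Id:
  assumes M: "M \<in> Ob C" and Z: "zero_object C Z"
  shows "short_exact C (Id C M) (Zero C M Z)"
proof -
  have ZO: "Z \<in> Ob C" using Z by (simp add: zero_object_def)
  note id = Id_in_Hom[OF M] and 0 = Zero_in_Hom[OF M ZO]
  have "epic C (Zero C M Z)" by (rule epicI[OF 0]) (use zero_object_Hom(2)[OF Z] in blast)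
  moreover have "is_kernel C (Id C M) (Zero C M Z)"
  proof (rule is_kernelI[OF 0 id])
    show "monic C (Id C M)" by (rule monicI[OF id]) (simp add: Id_Comp)
    show "Zero C M Z \<cdot> Id C M = Zero C M Z" using Comp_Id[OF 0] .
  qed (use Id_Comp in blast)
  ultimately show ?thesis by (rule short_exact_kernel)
qed

text \<open>
  The injective \<open>Cod c\<close> lets \<open>c\<close> extend to the whole object, which turns \<open>c\<close> and \<open>q\<close> into the two
  components of an epimorphism onto a biproduct and avoids the third isomorphism theorem.
\<close>

lemma short_exact_stack:
  assumes kq: "short_exact C k q" and lc: "short_exact C l c" and cod: "Cod C l = Dom C k"
    and inj: "injective_object C (Cod C c)" and bi: "biproduct C (Cod C c) (Cod C q) Z"
  shows "\<exists>e. short_exact C (k \<cdot> l) e \<and> Cod C e = Z"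
proof (rule short_exactE[OF kq], rule short_exactE[OF lc])
  let ?L = "Dom C l" and ?K = "Dom C k" and ?M = "Cod C k" and ?P = "Cod C c" and ?Q = "Cod C q"
  assume k: "k \<in> Hom C ?K ?M" and q: "q \<in> Hom C ?M ?Q" and qk: "q \<cdot> k = Zero C ?K ?Q"
    and kmon: "monic C k" and qepi: "epic C q"
    and kker: "\<And>W h. \<lbrakk>h \<in> Hom C W ?M; q \<cdot> h = Zero C W ?Q\<rbrakk> \<Longrightarrow> \<exists>u\<in>Hom C W ?K. k \<cdot> u = h"
    and "l \<in> Hom C ?L (Cod C l)" "c \<in> Hom C (Cod C l) ?P" and cl: "c \<cdot> l = Zero C ?L ?P"
    and lmon: "monic C l" and cepi: "epic C c"
    and "\<And>W h. \<lbrakk>h \<in> Hom C W (Cod C l); c \<cdot> h = Zero C W ?P\<rbrakk> \<Longrightarrow> \<exists>u\<in>Hom C W ?L. l \<cdot> u = h"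
  then have l: "l \<in> Hom C ?L ?K" and c: "c \<in> Hom C ?K ?P"
    and lker: "\<And>W h. \<lbrakk>h \<in> Hom C W ?K; c \<cdot> h = Zero C W ?P\<rbrakk> \<Longrightarrow> \<exists>u\<in>Hom C W ?L. l \<cdot> u = h"
    by (simp_all add: cod)
  have Ob: "?L \<in> Ob C" "?K \<in> Ob C" "?M \<in> Ob C" "?P \<in> Ob C" "?Q \<in> Ob C"
    using l k q c by (auto dest: HomD)
  obtain i j r s where i: "i \<in> Hom C ?P Z" and j: "j \<in> Hom C ?Q Z"
    and r: "r \<in> Hom C Z ?P" and s: "s \<in> Hom C Z ?Q"
    and ri: "r \<cdot> i = Id C ?P" and sj: "s \<cdot> j = Id C ?Q"
    and si: "s \<cdot> i = Zero C ?P ?Q" and rj: "r \<cdot> j = Zero C ?Q ?P"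
    and sum: "Plus C (i \<cdot> r) (j \<cdot> s) = Id C Z"
    using bi by (auto simp: biproduct_def)
  have Z: "Z \<in> Ob C" using HomD(5)[OF i] .
  obtain d where d: "d \<in> Hom C ?M ?P" "d \<cdot> k = c"
    using inj kmon c unfolding injective_object_def by blast
  \<comment> \<open>\<open>e\<close> is the arrow into the biproduct with components
    \<open>d\<close> and \<open>q\<close>.\<close>
  define e where "e = Plus C (i \<cdot> d) (j \<cdot> q)"
  have id: "i \<cdot> d \<in> Hom C ?M Z" and jq: "j \<cdot> q \<in> Hom C ?M Z" using Comp_in_Hom i j d q by auto
  have e: "e \<in> Hom C ?M Z" unfolding e_def by (rule Plus_in_Hom[OF id jq])
  have re: "r \<cdot> e = d"
    using Comp_Plus[OF r id jq] Comp_assoc[OF r i d(1)] Comp_assoc[OF r j q] ri rj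
      Id_Comp[OF d(1)] Zero_Comp[OF q Ob(4)] Plus_Zero[OF d(1)] by (simp add: e_def)
  have se: "s \<cdot> e = q"
    using Comp_Plus[OF s id jq] Comp_assoc[OF s i d(1)] Comp_assoc[OF s j q] si sj
      Id_Comp[OF q] Zero_Comp[OF d(1) Ob(5)] Zero_Plus[OF q] by (simp add: e_def)
  have ek: "e \<cdot> k = i \<cdot> c"
    using Plus_Comp[OF id jq k] Comp_assoc[OF i d(1) k] Comp_assoc[OF j q k] d(2) qk
      Comp_Zero[OF j Ob(2)] Plus_Zero[OF Comp_in_Hom[OF i c]] by (simp add: e_def)
  have kl: "k \<cdot> l \<in> Hom C ?L ?M" using Comp_in_Hom k l by blast
  have "epic C e"
  proof (rule epicI[OF e])
    fix W h
    assume h: "h \<in> Hom C Z W" and he: "h \<cdot> e = Zero C ?M W"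
    have W: "W \<in> Ob C" using HomD(5)[OF h] .
    \<comment> \<open>Restricting along \<open>k\<close> isolates the first component, since
      \<open>e \<cdot> k\<close> is \<open>i \<cdot> c\<close>. Once that component of
      \<open>h\<close> is zero, only \<open>(h \<cdot> j) \<cdot> q\<close> remains of
      \<open>h \<cdot> e\<close>.\<close>
    have "(h \<cdot> i) \<cdot> c = Zero C ?K W"
      using Comp_assoc[OF h i c] Comp_assoc[OF h e k] ek he Zero_Comp[OF k W] by simp
    then have hi: "h \<cdot> i = Zero C ?P W" using epic_zeroD[OF cepi c Comp_in_Hom[OF h i]] by blast
    have "h \<cdot> e = Plus C (Zero C ?M W) (h \<cdot> (j \<cdot> q))"
      using Comp_Plus[OF h id jq] Comp_assoc[OF h i d(1)] hi Zero_Comp[OF d(1) W]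
      by (simp add: e_def)
    then have "(h \<cdot> j) \<cdot> q = Zero C ?M W"
      using he Zero_Plus[OF Comp_in_Hom[OF h jq]] Comp_assoc[OF h j q] by simp
    then have hj: "h \<cdot> j = Zero C ?Q W" using epic_zeroD[OF qepi q Comp_in_Hom[OF h j]] by blast
    have "h = Plus C ((h \<cdot> i) \<cdot> r) ((h \<cdot> j) \<cdot> s)"
      using Comp_Plus[OF h Comp_in_Hom[OF i r] Comp_in_Hom[OF j s]] sum Comp_Id[OF h]
        Comp_assoc[OF h i r] Comp_assoc[OF h j s] by simp
    then show "h = Zero C Z W"
      using hi hj Zero_Comp[OF r W] Zero_Comp[OF s W] Plus_Zero[OF Zero_in_Hom[OF Z W]] by simp
  qed
  moreover have "is_kernel C (k \<cdot> l) e"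
  proof (rule is_kernelI[OF e kl])
    show "monic C (k \<cdot> l)"
    proof (rule monicI[OF kl])
      fix W h
      assume h: "h \<in> Hom C W ?L" and "(k \<cdot> l) \<cdot> h = Zero C W ?M"
      then have "k \<cdot> (l \<cdot> h) = Zero C W ?M" using Comp_assoc[OF k l h] by simp
      then have "l \<cdot> h = Zero C W ?K" using monic_zeroD[OF kmon k Comp_in_Hom[OF l h]] by blast
      then show "h = Zero C W ?L" using monic_zeroD[OF lmon l h] by blast
    qed
    show "e \<cdot> (k \<cdot> l) = Zero C ?L Z"
      using Comp_assoc[OF e k l] ek Comp_assoc[OF i c l] cl Comp_Zero[OF i Ob(1)] by simp
    fix W h
    assume h: "h \<in> Hom C W ?M" and eh: "e \<cdot> h = Zero C W Z"
    have W: "W \<in> Ob C" using HomD(4)[OF h] .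
    \<comment> \<open>An arrow killed by \<open>e\<close> is killed by both components:
      \<open>q\<close> lets it factor through \<open>k\<close>, and there \<open>d\<close> agrees
      with \<open>c\<close>, so it factors further through \<open>l\<close>.\<close>
    have qh: "q \<cdot> h = Zero C W ?Q" and dh: "d \<cdot> h = Zero C W ?P"
      using Comp_assoc[OF s e h] Comp_assoc[OF r e h] se re eh Comp_Zero[OF s W] Comp_Zero[OF r W]
      by auto
    obtain u where u: "u \<in> Hom C W ?K" "k \<cdot> u = h" using kker[OF h qh] by blast
    have "c \<cdot> u = Zero C W ?P" using Comp_assoc[OF d(1) k u(1)] d(2) u(2) dh by simp
    then obtain v where v: "v \<in> Hom C W ?L" "l \<cdot> v = u" using lker[OF u(1)] by blast
    then show "\<exists>u\<in>Hom C W ?L. (k \<cdot> l) \<cdot> u = h" using Comp_assoc[OF k l v(1)] u(2) by auto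
  qed
  ultimately show ?thesis using short_exact_kernel HomD(3)[OF e] by blast
qed

text \<open>Copies of \<open>S\<close> are split off one at a time: induction handles the kernel of
  a nonzero arrow to \<open>S\<close>, and \<open>short_exact_stack\<close> combines the quotient
  found there with the new copy.\<close>

lemma Add_quotient_exists:
  assumes fin: "\<And>X. X \<in> Ob C \<Longrightarrow> finite (Hom C X S)"
    and simple: "simple_object C S" and inj: "injective_object C S" and M: "M \<in> Ob C"
  shows "\<exists>m q. short_exact C m q \<and> Cod C m = M \<and>
    Hom C (Dom C m) S \<subseteq> {Zero C (Dom C m) S} \<and> Cod C q \<in> Add C S"
  using M
proof (induction "card (Hom C M S)" arbitrary: M rule: less_induct)
  case less
  have S: "S \<in> Ob C" using simple by (simp add: simple_object_def)
  show ?case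
  proof (cases "Hom C M S \<subseteq> {Zero C M S}")
    case True
    \<comment> \<open>With no nonzero arrow to \<open>S\<close>, the whole object is the subobject
      and the quotient is zero.\<close>
    obtain Z where Z: "zero_object C Z" using zero_object_exists by blast
    then have ZO: "Z \<in> Ob C" by (simp add: zero_object_def)
    show ?thesis
      using short_exact_Id[OF less.prems Z] True zero_object_in_Add[OF Z, of S]
        HomD(2,3)[OF Id_in_Hom[OF less.prems]] HomD(3)[OF Zero_in_Hom[OF less.prems ZO]]
      by (intro exI[of _ "Id C M"] exI[of _ "Zero C M Z"]) simp
  next
    case False
    then obtain f where f: "f \<in> Hom C M S" "f \<noteq> Zero C M S" by blast
    obtain k where "is_kernel C k f" using kernel_exists HomD(1)[OF f(1)] by blast
    then have kf: "short_exact C k f"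
      using short_exact_kernel simple_nonzero_epic[OF simple f] by blast
    have cods: "Cod C k = M" "Cod C f = S"
      using kf HomD[OF f(1)] by (simp_all add: short_exact_def is_kernel_def)
    have "monic C k" using kf by (rule short_exactE)
    then have k: "k \<in> Hom C (Dom C k) M" "f \<cdot> k = Zero C (Dom C k) S" "monic C k"
      using kf cods by (simp_all add: short_exact_def is_kernel_def Hom_def)
    have K: "Dom C k \<in> Ob C" using HomD(4)[OF k(1)] .
    let ?res = "\<lambda>g. g \<cdot> k"
    have "Hom C (Dom C k) S \<subseteq> ?res ` Hom C M S"
    proof
      fix g
      assume "g \<in> Hom C (Dom C k) S"
      then obtain h where "h \<in> Hom C (Cod C k) S" "h \<cdot> k = g"
        using inj k(3) unfolding injective_object_def by blast
      then show "g \<in> ?res ` Hom C M S" using cods(1) by blast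
    qed
    \<comment> \<open>\<open>f\<close> and the zero arrow have the same restriction to the kernel,
      so deleting \<open>f\<close> loses no value; this makes the induction measure drop
      strictly.\<close>
    also have "\<dots> \<subseteq> ?res ` (Hom C M S - {f})"
    proof -
      have "f \<cdot> k = Zero C M S \<cdot> k" using k Zero_Comp[OF k(1) S] by simp
      then show ?thesis using f(2) Zero_in_Hom[OF less.prems S] by blast
    qed
    finally have "card (Hom C (Dom C k) S) \<le> card (Hom C M S - {f})"
      using fin[OF less.prems] by (intro surj_card_le) simp
    also have "\<dots> < card (Hom C M S)"
      using fin[OF less.prems] f(1) by (rule card_Diff1_less)
    finally have "card (Hom C (Dom C k) S) < card (Hom C M S)" .
    then obtain l c where l: "short_exact C l c" "Cod C l = Dom C k"
      "Hom C (Dom C l) S \<subseteq> {Zero C (Dom C l) S}" "Cod C c \<in> Add C S"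
      using less.hyps[OF _ K] by blast
    have lH: "l \<in> Hom C (Dom C l) (Dom C k)"
      using l(1,2) by (simp add: short_exact_def is_kernel_def Hom_def)
    obtain Z where Z: "biproduct C (Cod C c) S Z"
      using biproduct_exists Add_in_Ob l(4) S by blast
    then obtain e where e: "short_exact C (k \<cdot> l) e" "Cod C e = Z"
      using short_exact_stack[OF kf l(1,2) Add_injective[OF inj l(4)]] cods(2) by blast
    have "Z \<in> Add C S" using biproduct_in_Add[OF l(4) self_in_Add[OF S] Z] .
    then show ?thesis
      using e l(3) HomD(2,3)[OF Comp_in_Hom[OF k(1) lH]]
      by (intro exI[of _ "k \<cdot> l"] exI[of _ e]) simp
  qed
qed

section \<open>Factorizing pairs from a simple injective or projective object\<close>

lemma injective_torsion_pair:
  assumes "\<And>X. X \<in> Ob C \<Longrightarrow> finite (Hom C X S)"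
    and "simple_object C S" and inj: "injective_object C S"
  shows "torsion_pair C {M \<in> Ob C. Hom C M S \<subseteq> {Zero C M S}} (Add C S)"
  unfolding torsion_pair_def
proof (intro conjI ballI)
  let ?D = "{M \<in> Ob C. Hom C M S \<subseteq> {Zero C M S}}"
  show "Add C S \<subseteq> Ob C" by (rule Add_in_Ob)
  show "?D \<subseteq> Ob C" by blast
  show "extension_closed C (Add C S)" using Add_extension_closed[OF inj] .
  show "extension_closed C ?D"
    unfolding extension_closed_def
  proof (intro allI impI, elim conjE)
    fix i p
    assume ip: "short_exact C i p" and "Dom C i \<in> ?D" "Cod C p \<in> ?D"
    then show "Cod C i \<in> ?D"
      using Hom_injective_exact[OF inj ip] short_exact_Ob(2)[OF ip] by simp
  qed
  show "Hom C X Y \<subseteq> {Zero C X Y}" if "X \<in> ?D" "Y \<in> Add C S" for X Y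
    using Hom_Add_zero that by blast
  show "\<exists>m q. short_exact C m q \<and> Cod C m = M \<and> Dom C m \<in> ?D \<and> Cod C q \<in> Add C S"
    if M: "M \<in> Ob C" for M
  proof -
    obtain m q where m: "short_exact C m q" "Cod C m = M"
      "Hom C (Dom C m) S \<subseteq> {Zero C (Dom C m) S}" "Cod C q \<in> Add C S"
      using Add_quotient_exists[OF assms M] by blast
    then show ?thesis
      using short_exact_Ob(1)[OF m(1)] by (intro exI[of _ m] exI[of _ q]) simp
  qed
qed

end

theorem proposition1p11:
  fixes C :: "('o, 'm) cat" and S :: 'o
  assumes "finitary_abelian_category C"
    and "finite_length_category C"
    and "simple_object C S"
  shows "(injective_object C S \<longrightarrow> factorizing_pair C (Add C S) (objects_without_factor C S)) \<and>
         (projective_object C S \<longrightarrow> factorizing_pair C (objects_without_factor C S) (Add C S))"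
proof (intro conjI impI)
  interpret finitary_abelian_category C by fact
  interpret op: abelian_category "opposite C"
    by (rule abelian_category_opposite) unfold_locales
  have S: "S \<in> Ob C" using assms(3) by (simp add: simple_object_def)
  {
    assume inj: "injective_object C S"
    have "objects_without_factor C S = {M \<in> Ob C. Hom C M S \<subseteq> {Zero C M S}}"
      by (rule objects_without_factor_eq[OF assms(2)])
        (use zero_object_Hom(2) Hom_injective_exact[OF inj] isomorphic_simple_iff(1)[OF _ assms(3)]
          in blast)+
    then show "factorizing_pair C (Add C S) (objects_without_factor C S)"
      using torsion_pair_factorizing[OF injective_torsion_pair[OF finite_Hom assms(3) inj]] S by simp
  next
    assume proj: "projective_object C S"
    have "objects_without_factor C S = {M \<in> Ob C. Hom C S M \<subseteq> {Zero C S M}}"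
      by (rule objects_without_factor_eq[OF assms(2)])
        (use zero_object_Hom(1) Hom_projective_exact[OF proj] isomorphic_simple_iff(2)[OF _ assms(3)]
          in blast)+
    \<comment> \<open>In the opposite category \<open>S\<close> is simple and injective, and arrows
      into \<open>S\<close> there are arrows out of \<open>S\<close> here. Dualizing back makes
      \<open>Add C S\<close> the class of subobjects.\<close>
    moreover have "torsion_pair (opposite C) {M \<in> Ob C. Hom C S M \<subseteq> {Zero C S M}} (Add C S)"
      using op.injective_torsion_pair[OF _ simple_object_opposite[OF assms(3)]] finite_Hom[OF S] proj
      by simp
    ultimately show "factorizing_pair C (objects_without_factor C S) (Add C S)"
      using torsion_pair_factorizing[OF torsion_pair_opposite] by simp
  }
qed

end
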